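(* Let $L_0,L_1,L_2,\ldots$ be a uniform sequence of supersolvable geometric lattices (with the accompanying data $\iota_n$, $\theta_s$, $t_n$ as described in the context), and let $\mathcal{L}_\infty$ be its direct limit. Then for every integer $k\ge 1$, the subposet \[\mathcal{L}^{(k)}_\infty=\{[x]\in\mathcal{L}_\infty:\ \nu([x])-\rho([x])<k\}\] of $\mathcal{L}_\infty$ is an upho lattice whose core is isomorphic to $L_k$.
   Context: Finite graded lattice: a finite lattice with $\hat0,\hat1$ and rank function $\rho$ such that all maximal chains have the same length; it is $n$-graded if that length is $n$. A finite lattice $L$ is semimodular if it is graded and $\rho(p)+\rho(q)\ge\rho(p\vee q)+\rho(p\wedge q)$ for all $p,q$; atomic if every element is a join of atoms; geometric if semimodular and atomic. An element $p$ of a semimodular lattice $L$ is modular if $\rho(p)+\rho(q)=\rho(p\vee q)+\rho(p\wedge q)$ for all $q\in L$. A uniform sequence of supersolvable geometric lattices is a sequence of finite geometric lattices $L_0,L_1,\ldots$ such that each $L_n$ is $n$-graded and $[a,\hat1_{L_n}]\cong L_{n-1}$ for every atom $a\in L_n$, together with (for each $n$) a fixed isomorphism $\theta_s:[s,\hat1_{L_n}]\to L_{n-1}$ for each atom $s\in L_n$ and a fixed embedding (isomorphism onto its image) $\iota_n:L_n\to L_{n+1}$, satisfying: (i) $\iota_{n-1}(\theta_s(x))=\theta_{\iota_n(s)}(\iota_n(x))$ for every atom $s\in L_n$ and every $x\in[s,\hat1_{L_n}]$; (ii) the image of $\iota_n$ is the interval $[\hat0_{L_{n+1}},t_n]$ for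 some modular coatom $t_n\in L_{n+1}$. Direct limit: $\mathcal{L}_\infty=\bigsqcup_n L_n/\sim$, where $\sim$ is the equivalence relation generated by $x\sim\iota_n(x)$ for $x\in L_n$; write $[x]$ for the class of $x$; the partial order is $[x]\le[y]$ iff $x'\le y'$ in some $L_n$ for some $x'\in[x]$, $y'\in[y]$. The rank is $\rho([x])=\rho(x)$ (well defined since the $\iota_n$ preserve rank), and $\nu([x])=\min\{n:\ \text{some representative of }[x]\text{ lies in }L_n\}$. A poset $\mathcal{P}$ is finite type $\mathbb{N}$-graded if it has a minimum $\hat0$, a rank function $\rho:\mathcal{P}\to\mathbb{N}$ with $\rho(\hat0)=0$ such that every maximal chain has the form $\hat0=x_0\lessdot x_1\lessdot x_2\lessdot\cdots$ with $\rho(x_i)=i$, and only finitely many elements of each rank. An upho lattice is a finite type $\mathbb{N}$-graded lattice $\mathcal{L}$ with at least two elements such that for every $p\in\mathcal{L}$ the principal order filter $\{q\in\mathcal{L}:q\ge p\}$ is isomorphic as a poset to $\mathcal{L}$. Its core is the interval $[\hat0,s_1\vee\cdots\vee s_r]$ where $s_1,\ldots,s_r$ are the atoms of $\mathcal{L}$. *)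

theory Defs
  imports "HOL-Algebra.Lattice"
begin

text \<open>
  Posets are the carrier-based records \<open>'a gorder\<close> of HOL-Algebra; a subposet is obtained by
  updating the carrier.
\<close>

definition interval :: "'a gorder \<Rightarrow> 'a \<Rightarrow> 'a \<Rightarrow> 'a gorder" where
  "interval P a b = P\<lparr>carrier := \<lbrace>a..b\<rbrace>\<^bsub>P\<^esub>\<rparr>"

definition principal_filter :: "'a gorder \<Rightarrow> 'a \<Rightarrow> 'a gorder" where
  "principal_filter P p = P\<lparr>carrier := {q \<in> carrier P. p \<sqsubseteq>\<^bsub>P\<^esub> q}\<rparr>"

definition order_iso :: "'a gorder \<Rightarrow> 'b gorder \<Rightarrow> ('a \<Rightarrow> 'b) \<Rightarrow> bool" where
  "order_iso P Q f \<longleftrightarrow> order_emb P Q f \<and> bij_betw f (carrier P) (carrier Q)"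

definition order_isomorphic :: "'a gorder \<Rightarrow> 'b gorder \<Rightarrow> bool" where
  "order_isomorphic P Q \<longleftrightarrow> (\<exists>f. order_iso P Q f)"

definition covers :: "'a gorder \<Rightarrow> 'a \<Rightarrow> 'a \<Rightarrow> bool" where
  "covers P y x \<longleftrightarrow> x \<in> carrier P \<and> y \<in> carrier P \<and> x \<sqsubset>\<^bsub>P\<^esub> y \<and>
     \<not> (\<exists>z\<in>carrier P. x \<sqsubset>\<^bsub>P\<^esub> z \<and> z \<sqsubset>\<^bsub>P\<^esub> y)"

definition atoms :: "'a gorder \<Rightarrow> 'a set" where
  "atoms P = {s. covers P s \<bottom>\<^bsub>P\<^esub>}"

definition coatoms :: "'a gorder \<Rightarrow> 'a set" where
  "coatoms P = {t. covers P \<top>\<^bsub>P\<^esub> t}"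

definition maximal_chain :: "'a gorder \<Rightarrow> 'a set \<Rightarrow> bool" where
  "maximal_chain P C \<longleftrightarrow> pred_on.maxchain (carrier P) (le P) C"

definition rank_function :: "'a gorder \<Rightarrow> ('a \<Rightarrow> nat) \<Rightarrow> bool" where
  "rank_function P \<rho> \<longleftrightarrow> \<rho> \<bottom>\<^bsub>P\<^esub> = 0 \<and> (\<forall>x y. covers P y x \<longrightarrow> \<rho> y = Suc (\<rho> x))"

text \<open>
  On a finite poset with minimum, two rank functions agree on the carrier, so the choice below
  is immaterial there.
\<close>

definition rank :: "'a gorder \<Rightarrow> 'a \<Rightarrow> nat" where
  "rank P = (SOME \<rho>. rank_function P \<rho>)"

text \<open>The length of a chain is one less than its number of elements.\<close>

definition n_graded :: "nat \<Rightarrow> 'a gorder \<Rightarrow> bool" where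
  "n_graded n P \<longleftrightarrow> bounded_lattice P \<and> finite (carrier P) \<and> (\<exists>\<rho>. rank_function P \<rho>) \<and>
     (\<forall>C. maximal_chain P C \<longrightarrow> card C = n + 1)"

definition semimodular :: "'a gorder \<Rightarrow> bool" where
  "semimodular P \<longleftrightarrow> (\<exists>n. n_graded n P) \<and>
     (\<forall>p\<in>carrier P. \<forall>q\<in>carrier P.
        rank P p + rank P q \<ge> rank P (p \<squnion>\<^bsub>P\<^esub> q) + rank P (p \<sqinter>\<^bsub>P\<^esub> q))"

definition atomic :: "'a gorder \<Rightarrow> bool" where
  "atomic P \<longleftrightarrow> (\<forall>x\<in>carrier P. \<exists>A\<subseteq>atoms P. x = \<Squnion>\<^bsub>P\<^esub>A)"

definition geometric :: "'a gorder \<Rightarrow> bool" where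
  "geometric P \<longleftrightarrow> semimodular P \<and> atomic P"

definition modular_element :: "'a gorder \<Rightarrow> 'a \<Rightarrow> bool" where
  "modular_element P p \<longleftrightarrow> p \<in> carrier P \<and>
     (\<forall>q\<in>carrier P. rank P p + rank P q = rank P (p \<squnion>\<^bsub>P\<^esub> q) + rank P (p \<sqinter>\<^bsub>P\<^esub> q))"

text \<open>
  \<open>\<theta> n s\<close> is the isomorphism attached to the atom \<open>s\<close> of \<open>L n\<close>; it is only constrained for
  \<open>n \<ge> 1\<close>, as \<open>L 0\<close> is a single point.  The coatom \<open>t n\<close> lives in \<open>L (Suc n)\<close>.
\<close>

locale uniform_sequence =
  fixes L :: "nat \<Rightarrow> 'a gorder"
    and \<theta> :: "nat \<Rightarrow> 'a \<Rightarrow> 'a \<Rightarrow> 'a"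
    and \<iota> :: "nat \<Rightarrow> 'a \<Rightarrow> 'a"
    and t :: "nat \<Rightarrow> 'a"
  assumes geometric_L: "geometric (L n)"
    and graded_L: "n_graded n (L n)"
    and theta_iso: "s \<in> atoms (L (Suc n)) \<Longrightarrow>
          order_iso (interval (L (Suc n)) s \<top>\<^bsub>L (Suc n)\<^esub>) (L n) (\<theta> (Suc n) s)"
    and iota_closed: "\<iota> n \<in> carrier (L n) \<rightarrow> carrier (L (Suc n))"
    and iota_emb: "order_emb (L n) (L (Suc n)) (\<iota> n)"
    and iota_theta: "s \<in> atoms (L (Suc n)) \<Longrightarrow> x \<in> \<lbrace>s..\<top>\<^bsub>L (Suc n)\<^esub>\<rbrace>\<^bsub>L (Suc n)\<^esub> \<Longrightarrow>
          \<iota> n (\<theta> (Suc n) s x) = \<theta> (Suc (Suc n)) (\<iota> (Suc n) s) (\<iota> (Suc n) x)"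
    and t_coatom: "t n \<in> coatoms (L (Suc n))"
    and t_modular: "modular_element (L (Suc n)) (t n)"
    and iota_image: "\<iota> n ` carrier (L n) = \<lbrace>\<bottom>\<^bsub>L (Suc n)\<^esub>..t n\<rbrace>\<^bsub>L (Suc n)\<^esub>"

text \<open>
  The disjoint union of the \<open>L n\<close> is the set of pairs \<open>(n, x)\<close> with \<open>x\<close> in \<open>L n\<close>; the elements
  of the direct limit are equivalence classes of such pairs.
\<close>

definition limit_step :: "(nat \<Rightarrow> 'a gorder) \<Rightarrow> (nat \<Rightarrow> 'a \<Rightarrow> 'a) \<Rightarrow> nat \<times> 'a \<Rightarrow> nat \<times> 'a \<Rightarrow> bool"
  where "limit_step L \<iota> p q \<longleftrightarrow> (\<exists>n. \<exists>x\<in>carrier (L n). p = (n, x) \<and> q = (Suc n, \<iota> n x))"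

definition direct_limit ::
  "(nat \<Rightarrow> 'a gorder) \<Rightarrow> (nat \<Rightarrow> 'a \<Rightarrow> 'a) \<Rightarrow> (nat \<times> 'a) set gorder" where
  "direct_limit L \<iota> =
     \<lparr>carrier = (SIGMA n:UNIV. carrier (L n)) // {(p, q). equivclp (limit_step L \<iota>) p q},
      eq = (=),
      le = (\<lambda>X Y. \<exists>n x y. (n, x) \<in> X \<and> (n, y) \<in> Y \<and> x \<sqsubseteq>\<^bsub>L n\<^esub> y)\<rparr>"

definition limit_rank :: "(nat \<Rightarrow> 'a gorder) \<Rightarrow> (nat \<times> 'a) set \<Rightarrow> nat" where
  "limit_rank L X = (THE r. \<exists>n x. (n, x) \<in> X \<and> r = rank (L n) x)"

definition limit_nu :: "(nat \<times> 'a) set \<Rightarrow> nat" where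
  "limit_nu X = (LEAST n. \<exists>x. (n, x) \<in> X)"

definition limit_sub ::
  "(nat \<Rightarrow> 'a gorder) \<Rightarrow> (nat \<Rightarrow> 'a \<Rightarrow> 'a) \<Rightarrow> nat \<Rightarrow> (nat \<times> 'a) set gorder" where
  "limit_sub L \<iota> k = (direct_limit L \<iota>)
     \<lparr>carrier := {X \<in> carrier (direct_limit L \<iota>). int (limit_nu X) - int (limit_rank L X) < int k}\<rparr>"

definition finite_type_N_graded :: "'a gorder \<Rightarrow> bool" where
  "finite_type_N_graded P \<longleftrightarrow> partial_order P \<and> (\<exists>b. least P b (carrier P)) \<and>
     (\<exists>\<rho>. rank_function P \<rho> \<and>
        (\<forall>C. maximal_chain P C \<longrightarrow>
           (\<exists>x :: nat \<Rightarrow> 'a. C = range x \<and> x 0 = \<bottom>\<^bsub>P\<^esub> \<and>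
              (\<forall>i. covers P (x (Suc i)) (x i) \<and> \<rho> (x i) = i))) \<and>
        (\<forall>i. finite {x \<in> carrier P. \<rho> x = i}))"

definition upho_lattice :: "'a gorder \<Rightarrow> bool" where
  "upho_lattice P \<longleftrightarrow> lattice P \<and> finite_type_N_graded P \<and>
     (\<exists>x\<in>carrier P. \<exists>y\<in>carrier P. x \<noteq> y) \<and>
     (\<forall>p\<in>carrier P. order_isomorphic (principal_filter P p) P)"

definition core :: "'a gorder \<Rightarrow> 'a gorder" where
  "core P = interval P \<bottom>\<^bsub>P\<^esub> (\<Squnion>\<^bsub>P\<^esub>(atoms P))"

end

theory Submission
  imports Defs
begin

text \<open>
  Write \<open>T n\<close> for the image of the top of \<open>L n\<close> in the direct limit, so that \<open>L n\<close> becomes the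
  ideal below \<open>T n\<close> and \<open>\<nu> x \<le> n\<close> means \<open>x \<le> T n\<close>.  Modularity of \<open>t n\<close> says that an \<open>x\<close> in
  \<open>L (n + 1)\<close> but not in \<open>L n\<close> covers \<open>x \<sqinter> T n\<close>, so descending one stage lowers \<open>\<nu>\<close> and \<open>\<rho>\<close> at the
  same time; this makes the elements with \<open>\<nu> - \<rho> < k\<close> a graded poset with the rank of the limit.
  They are closed under joins because joins do not raise \<open>\<nu>\<close> beyond the maximum, and finiteness of
  lower ideals then gives meets.  The maps \<open>\<theta>\<close> glue to isomorphisms from the filter above an atom
  \<open>s\<close> onto the limit which match \<open>L (n + 1)\<close> with \<open>L n\<close> as soon as \<open>s\<close> lies in \<open>L (n + 1)\<close>, and
  hence restrict to the subposet; induction on the rank treats arbitrary filters.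
\<close>

section \<open>Rank functions on finite posets\<close>

lemma at_least_at_most_iff:
  "x \<in> \<lbrace>a..b\<rbrace>\<^bsub>P\<^esub> \<longleftrightarrow> x \<in> carrier P \<and> a \<sqsubseteq>\<^bsub>P\<^esub> x \<and> x \<sqsubseteq>\<^bsub>P\<^esub> b"
  by (auto simp: at_least_at_most_def)

lemma rank_function_rank:
  assumes "n_graded n P"
  shows "rank_function P (rank P)"
  using assms unfolding n_graded_def rank_def by (metis someI_ex)

lemma (in partial_order) partial_order_subset:
  assumes "A \<subseteq> carrier L"
  shows "partial_order (L\<lparr>carrier := A\<rparr>)"
proof -
  interpret Q: weak_partial_order "L\<lparr>carrier := A\<rparr>"
    by (rule weak_partial_order_subset[OF weak_partial_order_axioms assms])
  show ?thesis
    by unfold_locales (simp add: eq_is_equal)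
qed

lemma (in partial_order) bottom_unique:
  assumes "least L b (carrier L)"
  shows "\<bottom> = b"
  unfolding bottom_def by (rule some_equality) (use assms least_unique in auto)

lemma (in partial_order) sup_unique:
  assumes "is_lub L s A"
  shows "\<Squnion>A = s"
  unfolding sup_def by (rule some_equality) (use assms least_unique in auto)

text \<open>The third fact is maximality in the form used later: adjoining an element comparable
  with all of \<open>C\<close> gives a chain, and this chain cannot be strictly larger than
  \<open>C\<close>.\<close>

lemma maximal_chainD:
  fixes L :: "'a gorder" (structure)
  assumes "partial_order L" "maximal_chain L C"
  shows "C \<subseteq> carrier L"
    and "\<lbrakk>x \<in> C; y \<in> C\<rbrakk> \<Longrightarrow> x \<sqsubseteq> y \<or> y \<sqsubseteq> x"
    and "\<lbrakk>z \<in> carrier L; \<And>y. y \<in> C \<Longrightarrow> y \<sqsubseteq> z \<or> z \<sqsubseteq> y\<rbrakk> \<Longrightarrow> z \<in> C"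
proof -
  interpret partial_order L by fact
  have chain: "pred_on.chain (carrier L) (\<sqsubseteq>) C"
    and max: "\<And>S. pred_on.chain (carrier L) (\<sqsubseteq>) S \<Longrightarrow> \<not> C \<subset> S"
    using assms unfolding maximal_chain_def pred_on.maxchain_def by blast+
  then show sub: "C \<subseteq> carrier L"
    unfolding pred_on.chain_def by blast
  show cmp: "x \<sqsubseteq> y \<or> y \<sqsubseteq> x" if "x \<in> C" "y \<in> C" for x y
    using pred_on.chain_total[OF chain that] sub that by auto
  show "z \<in> C" if z: "z \<in> carrier L" "\<And>y. y \<in> C \<Longrightarrow> y \<sqsubseteq> z \<or> z \<sqsubseteq> y"
  proof -
    have "pred_on.chain (carrier L) (\<sqsubseteq>) (insert z C)"
    proof (rule pred_on.chainI)
      show "(\<sqsubseteq>)\<^sup>=\<^sup>= x y \<or> (\<sqsubseteq>)\<^sup>=\<^sup>= y x" if "x \<in> insert z C" "y \<in> insert z C" for x y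
        using that cmp[of x y] z(2)[of x] z(2)[of y] by auto
    qed (use sub z(1) in auto)
    then show ?thesis using max[of "insert z C"] by blast
  qed
qed

lemma is_lub_pair_iff:
  assumes "x \<in> carrier P" "y \<in> carrier P"
  shows "is_lub P s {x, y} \<longleftrightarrow> s \<in> carrier P \<and> x \<sqsubseteq>\<^bsub>P\<^esub> s \<and> y \<sqsubseteq>\<^bsub>P\<^esub> s \<and>
    (\<forall>u\<in>carrier P. x \<sqsubseteq>\<^bsub>P\<^esub> u \<longrightarrow> y \<sqsubseteq>\<^bsub>P\<^esub> u \<longrightarrow> s \<sqsubseteq>\<^bsub>P\<^esub> u)"
  using assms by (auto simp: least_def Upper_def)

lemma is_glb_pair_iff:
  assumes "x \<in> carrier P" "y \<in> carrier P"
  shows "is_glb P s {x, y} \<longleftrightarrow> s \<in> carrier P \<and> s \<sqsubseteq>\<^bsub>P\<^esub> x \<and> s \<sqsubseteq>\<^bsub>P\<^esub> y \<and>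
    (\<forall>u\<in>carrier P. u \<sqsubseteq>\<^bsub>P\<^esub> x \<longrightarrow> u \<sqsubseteq>\<^bsub>P\<^esub> y \<longrightarrow> u \<sqsubseteq>\<^bsub>P\<^esub> s)"
  using assms by (auto simp: greatest_def Lower_def)

section \<open>Covers and ranks in finite posets\<close>

locale finite_partial_order = partial_order P for P :: "'a gorder" (structure) +
  assumes finite_carrier: "finite (carrier P)"
begin

text \<open>Replace \<open>x\<close> by an element strictly between \<open>x\<close> and
  \<open>y\<close> as long as there is one; finiteness ends this at a lower cover of
  \<open>y\<close>.\<close>

lemma cover_below:
  assumes "x \<in> carrier P" "y \<in> carrier P" "x \<sqsubset> y"
  obtains z where "covers P y z" "x \<sqsubseteq> z"
proof -
  have "\<exists>z. covers P y z \<and> x \<sqsubseteq> z"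
    using assms
  proof (induction "card {z \<in> carrier P. x \<sqsubset> z \<and> z \<sqsubset> y}" arbitrary: x rule: less_induct)
    case less
    show ?case
    proof (cases "covers P y x")
      case True
      then show ?thesis using less.prems by auto
    next
      case False
      then obtain w where w: "w \<in> carrier P" "x \<sqsubset> w" "w \<sqsubset> y"
        using less.prems unfolding covers_def by auto
      have "card {z \<in> carrier P. w \<sqsubset> z \<and> z \<sqsubset> y} < card {z \<in> carrier P. x \<sqsubset> z \<and> z \<sqsubset> y}"
        using w less.prems lless_trans[OF w(2)] finite_carrier
        by (intro psubset_card_mono) (auto simp: lless_eq)
      from less.hyps[OF this] w less.prems obtain z where "covers P y z" "w \<sqsubseteq> z"
        by blast
      then show ?thesis
        using w less.prems by (meson covers_def le_trans lless_imp_le)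
    qed
  qed
  then show ?thesis using that by blast
qed

lemma rank_function_strict_mono:
  assumes "rank_function P \<rho>" "x \<in> carrier P" "y \<in> carrier P" "x \<sqsubset> y"
  shows "\<rho> x < \<rho> y"
  using assms(3,4)
proof (induction "card {z \<in> carrier P. z \<sqsubset> y}" arbitrary: y rule: less_induct)
  case less
  obtain z where z: "covers P y z" "x \<sqsubseteq> z"
    using cover_below[OF assms(2) less.prems] .
  then have zc: "z \<in> carrier P" "z \<sqsubset> y" and \<rho>: "\<rho> y = Suc (\<rho> z)"
    using assms(1) by (auto simp: covers_def rank_function_def)
  show ?case
  proof (cases "x = z")
    case False
    have "card {u \<in> carrier P. u \<sqsubset> z} < card {u \<in> carrier P. u \<sqsubset> y}"
      using zc less.prems lless_trans[OF _ zc(2)] finite_carrier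
      by (intro psubset_card_mono) (auto simp: lless_eq)
    with False z zc less.hyps[of z] \<rho> show ?thesis
      by (auto simp: lless_eq)
  qed (simp add: \<rho>)
qed

text \<open>A descent from \<open>x\<close> to the bottom along covers lowers both ranks by one at
  each step, so only the offset at the bottom remains. It suffices that \<open>f\<close> preserves
  covers, and the lemma serves both the embeddings \<open>\<iota>\<close> and the inverses of the
  \<open>\<theta>\<close>.\<close>

lemma rank_function_shift:
  assumes "rank_function P \<rho>" "rank_function Q \<sigma>"
    and b: "least P \<bottom> (carrier P)"
    and covers: "\<And>x y. covers P y x \<Longrightarrow> covers Q (f y) (f x)"
    and "x \<in> carrier P"
  shows "\<sigma> (f x) = \<sigma> (f \<bottom>) + \<rho> x"
  using \<open>x \<in> carrier P\<close>
proof (induction "\<rho> x" arbitrary: x rule: less_induct)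
  case less
  show ?case
  proof (cases "x = \<bottom>")
    case True
    then show ?thesis using assms(1) by (simp add: rank_function_def)
  next
    case False
    then have "\<bottom> \<sqsubset> x"
      using b less.prems by (auto simp: lless_eq least_def)
    then obtain z where z: "covers P x z"
      using cover_below[of \<bottom> x] b less.prems by (auto simp: least_def)
    then have "\<rho> x = Suc (\<rho> z)" "\<sigma> (f x) = Suc (\<sigma> (f z))" "z \<in> carrier P"
      using assms(1,2) covers by (auto simp: rank_function_def covers_def)
    then show ?thesis using less.hyps[of z] by simp
  qed
qed

end

section \<open>Towers of principal ideals\<close>

text \<open>These axioms are all that the argument about slices needs from the direct limit, so
  equivalence classes appear only when the axioms are verified. \<open>T 0\<close> is the minimum,
  \<open>meet_T\<close> encodes modularity of the coatoms \<open>t n\<close>,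
  \<open>atoms_join\<close> encodes atomicity, and the last clause of \<open>filter_iso\<close> says
  that passing from the filter above \<open>s\<close> to \<open>P\<close> lowers the stage by
  one.\<close>

locale rank_tower = partial_order P for P :: "'b gorder" (structure) +
  fixes T :: "nat \<Rightarrow> 'b" and \<rho> :: "'b \<Rightarrow> nat"
  assumes T_closed [simp]: "T n \<in> carrier P"
    and T_Suc: "T n \<sqsubseteq> T (Suc n)"
    and below_T: "x \<in> carrier P \<Longrightarrow> \<exists>n. x \<sqsubseteq> T n"
    and finite_below: "finite {x \<in> carrier P. x \<sqsubseteq> T n}"
    and T_0_le: "x \<in> carrier P \<Longrightarrow> T 0 \<sqsubseteq> x"
    and rank_T [simp]: "\<rho> (T n) = n"
    and rank_strict: "\<lbrakk>x \<in> carrier P; y \<in> carrier P; x \<sqsubseteq> y; x \<noteq> y\<rbrakk> \<Longrightarrow> \<rho> x < \<rho> y"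
    and step_down: "\<lbrakk>x \<in> carrier P; y \<in> carrier P; x \<sqsubseteq> y; x \<noteq> y\<rbrakk> \<Longrightarrow>
          \<exists>z\<in>carrier P. x \<sqsubseteq> z \<and> z \<sqsubseteq> y \<and> \<rho> y = Suc (\<rho> z)"
    and join_exists: "\<lbrakk>x \<in> carrier P; y \<in> carrier P\<rbrakk> \<Longrightarrow> \<exists>s. least P s (Upper P {x, y})"
    and meet_T: "\<lbrakk>x \<in> carrier P; x \<sqsubseteq> T (Suc n); \<not> x \<sqsubseteq> T n\<rbrakk> \<Longrightarrow>
          \<exists>z\<in>carrier P. z \<sqsubseteq> x \<and> z \<sqsubseteq> T n \<and> \<rho> x = Suc (\<rho> z) \<and>
            (\<forall>w\<in>carrier P. w \<sqsubseteq> x \<longrightarrow> w \<sqsubseteq> T n \<longrightarrow> w \<sqsubseteq> z)"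
    and atoms_join: "\<lbrakk>z \<in> carrier P;
          \<And>s. \<lbrakk>s \<in> carrier P; \<rho> s = 1; s \<sqsubseteq> T n\<rbrakk> \<Longrightarrow> s \<sqsubseteq> z\<rbrakk> \<Longrightarrow> T n \<sqsubseteq> z"
    and filter_iso: "\<lbrakk>s \<in> carrier P; \<rho> s = 1\<rbrakk> \<Longrightarrow>
          \<exists>\<phi>. order_iso (principal_filter P s) P \<phi> \<and>
            (\<forall>x\<in>carrier P. s \<sqsubseteq> x \<longrightarrow> \<rho> x = Suc (\<rho> (\<phi> x)) \<and>
              (\<forall>n. s \<sqsubseteq> T (Suc n) \<longrightarrow> (x \<sqsubseteq> T (Suc n) \<longleftrightarrow> \<phi> x \<sqsubseteq> T n)))"
begin

text \<open>As introduction rules these make classical proof search diverge.\<close>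

declare le_cong_l [rule del] le_cong_r [rule del] le_antisym [rule del]

section \<open>Slices of a tower and their minimum\<close>

lemma T_mono: "m \<le> n \<Longrightarrow> T m \<sqsubseteq> T n"
proof (induction rule: dec_induct)
  case (step n)
  then show ?case using le_trans[OF step.IH T_Suc] by simp
qed simp

lemma le_T_mono: "\<lbrakk>x \<sqsubseteq> T m; m \<le> n; x \<in> carrier P\<rbrakk> \<Longrightarrow> x \<sqsubseteq> T n"
  by (rule le_trans[OF _ T_mono]) auto

lemma rank_mono: "\<lbrakk>x \<in> carrier P; y \<in> carrier P; x \<sqsubseteq> y\<rbrakk> \<Longrightarrow> \<rho> x \<le> \<rho> y"
  using rank_strict[of x y] by (cases "x = y") auto

lemma rank_0: "\<lbrakk>x \<in> carrier P; \<rho> x = 0\<rbrakk> \<Longrightarrow> x = T 0"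
  using rank_strict[of "T 0" x] T_0_le[of x] by (cases "x = T 0") auto

lemma T_inj: "T m = T n \<Longrightarrow> m = n"
  by (metis rank_T)

text \<open>With \<open>k = Suc j\<close>, the condition \<open>\<nu> x - \<rho> x < k\<close> reads \<open>x \<sqsubseteq> T (j + \<rho> x)\<close>.\<close>

definition slice :: "nat \<Rightarrow> 'b gorder" where
  "slice j = P\<lparr>carrier := {x \<in> carrier P. x \<sqsubseteq> T (j + \<rho> x)}\<rparr>"

lemma slice_simps [simp]:
  "x \<in> carrier (slice j) \<longleftrightarrow> x \<in> carrier P \<and> x \<sqsubseteq> T (j + \<rho> x)"
  "le (slice j) = le P" "eq (slice j) = (=)"
  by (auto simp: slice_def eq_is_equal)

lemma partial_order_slice: "partial_order (slice j)"
  unfolding slice_def by (rule partial_order_subset) auto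

lemma lless_slice: "x \<sqsubset>\<^bsub>slice j\<^esub> y \<longleftrightarrow> x \<sqsubseteq> y \<and> x \<noteq> y"
  by (simp add: lless_def)

lemma T_in_slice: "T n \<in> carrier (slice j)"
  by (simp add: T_mono)

lemma bottom_slice_least: "least (slice j) (T 0) (carrier (slice j))"
  by (auto simp: least_def T_0_le T_mono)

lemma bottom_slice: "\<bottom>\<^bsub>slice j\<^esub> = T 0"
  by (rule partial_order.bottom_unique[OF partial_order_slice bottom_slice_least])

section \<open>Covers and rank in a slice\<close>

text \<open>
  If \<open>x\<close> lies below the last \<open>T m\<close> that is not above \<open>y\<close>, the modular meet \<open>y \<sqinter> T m\<close> stays in
  the slice; otherwise every element between \<open>x\<close> and \<open>y\<close> has the same \<open>\<nu>\<close> as \<open>x\<close>.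
\<close>

lemma slice_step_down:
  assumes x: "x \<in> carrier (slice j)" and y: "y \<in> carrier (slice j)"
    and xy: "x \<sqsubseteq> y" "x \<noteq> y"
  obtains z where "z \<in> carrier (slice j)" "x \<sqsubseteq> z" "z \<sqsubseteq> y" "\<rho> y = Suc (\<rho> z)"
proof -
  have xP: "x \<in> carrier P" and yP: "y \<in> carrier P" using x y by auto
  \<comment> \<open>This \<open>n\<close> is the value of \<open>\<nu>\<close> at
    \<open>y\<close>.\<close>
  define n where "n = (LEAST n. y \<sqsubseteq> T n)"
  have n: "y \<sqsubseteq> T n" using below_T[OF yP] unfolding n_def by (rule LeastI_ex)
  have n_le: "n \<le> m" if "y \<sqsubseteq> T m" for m
    unfolding n_def using that by (rule Least_le)
  have "n \<noteq> 0"
  proof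
    assume "n = 0"
    then have "y = T 0" using n T_0_le[OF yP] yP by (simp add: le_antisym)
    then show False using xy xP T_0_le[OF xP] le_antisym by auto
  qed
  then obtain m where m: "n = Suc m" using not0_implies_Suc by blast
  have ym: "\<not> y \<sqsubseteq> T m" using n_le[of m] m by auto
  show ?thesis
  proof (cases "x \<sqsubseteq> T m")
    case True
    obtain z where z: "z \<in> carrier P" "z \<sqsubseteq> y" "z \<sqsubseteq> T m" "\<rho> y = Suc (\<rho> z)" "x \<sqsubseteq> z"
      using meet_T[OF yP _ ym] n m True xy xP by blast
    \<comment> \<open>The stage of \<open>y\<close> is at most \<open>j + \<rho> y\<close>; from
      \<open>y\<close> to \<open>z\<close> the bounds on stage and rank both drop by one, so
      \<open>z\<close> still satisfies the slice condition.\<close>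
    have "Suc m \<le> j + \<rho> y" using n_le y m by auto
    then have "z \<in> carrier (slice j)" using z le_T_mono by simp
    then show ?thesis using that z by blast
  next
    case False
    obtain z where z: "z \<in> carrier P" "z \<sqsubseteq> y" "\<rho> y = Suc (\<rho> z)" "x \<sqsubseteq> z"
      using step_down[OF xP yP xy] by blast
    \<comment> \<open>The slice condition puts \<open>x\<close> below
      \<open>T (j + \<rho> x)\<close>, while \<open>x\<close> is not below \<open>T m\<close>; hence
      \<open>m < j + \<rho> x\<close>. The rank of \<open>z\<close> is at least that of
      \<open>x\<close>, so \<open>T (j + \<rho> z)\<close> is above \<open>T (Suc m)\<close> and
      therefore above \<open>z\<close>.\<close>
    have "\<not> j + \<rho> x \<le> m" using False le_T_mono x by auto
    then have "Suc m \<le> j + \<rho> z" using rank_mono[OF xP z(1,4)] by simp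
    then have "z \<in> carrier (slice j)"
      using le_T_mono le_trans[OF z(2) n] yP z(1) m by auto
    then show ?thesis using that z by blast
  qed
qed

text \<open>Repeated use of \<open>slice_step_down\<close> starting at \<open>y\<close> descends one
  rank at a time without leaving the slice; the last element before \<open>x\<close> is the desired
  one.\<close>

lemma slice_step_up:
  assumes "x \<in> carrier (slice j)" "y \<in> carrier (slice j)" "x \<sqsubseteq> y" "x \<noteq> y"
  obtains z where "z \<in> carrier (slice j)" "x \<sqsubseteq> z" "z \<sqsubseteq> y" "\<rho> z = Suc (\<rho> x)"
proof -
  have "\<exists>z\<in>carrier (slice j). x \<sqsubseteq> z \<and> z \<sqsubseteq> y \<and> \<rho> z = Suc (\<rho> x)"
    using assms(2-4)
  proof (induction "\<rho> y" arbitrary: y rule: less_induct)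
    case less
    obtain z where z: "z \<in> carrier (slice j)" "x \<sqsubseteq> z" "z \<sqsubseteq> y" "\<rho> y = Suc (\<rho> z)"
      using slice_step_down[OF assms(1) less.prems] .
    show ?case
    proof (cases "x = z")
      case True
      then show ?thesis using z less.prems by auto
    next
      case False
      then obtain w where "w \<in> carrier (slice j)" "x \<sqsubseteq> w" "w \<sqsubseteq> z" "\<rho> w = Suc (\<rho> x)"
        using less.hyps[of z] z by auto
      then show ?thesis
        using z(1,3) less.prems(1) by (auto intro: le_trans)
    qed
  qed
  then show ?thesis using that by blast
qed

text \<open>If \<open>y\<close> covers \<open>x\<close>, the element of rank
  \<open>\<rho> x + 1\<close> from \<open>slice_step_up\<close> has to be \<open>y\<close>.
  Conversely strictness of \<open>\<rho>\<close> leaves no room between consecutive ranks. Hence the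
  rank of the limit is also the rank of the slice.\<close>

lemma covers_slice_iff:
  "covers (slice j) y x \<longleftrightarrow>
     x \<in> carrier (slice j) \<and> y \<in> carrier (slice j) \<and> x \<sqsubseteq> y \<and> \<rho> y = Suc (\<rho> x)"
    (is "?L \<longleftrightarrow> ?R")
proof
  assume L: ?L
  then have xy: "x \<in> carrier (slice j)" "y \<in> carrier (slice j)" "x \<sqsubseteq> y" "x \<noteq> y"
    unfolding covers_def lless_slice by auto
  then obtain z where z: "z \<in> carrier (slice j)" "x \<sqsubseteq> z" "z \<sqsubseteq> y" "\<rho> z = Suc (\<rho> x)"
    using slice_step_up by blast
  then have "z = y"
    using L unfolding covers_def lless_slice by (metis n_not_Suc_n)
  then show ?R using xy z by auto
next
  assume R: ?R
  then have "z = x \<or> z = y" if "z \<in> carrier P" "x \<sqsubseteq> z" "z \<sqsubseteq> y" for z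
    using rank_strict[of x z] rank_strict[of z y] that by fastforce
  moreover have "x \<noteq> y" using R by auto
  ultimately have "\<not> (\<exists>z\<in>carrier (slice j). (x \<sqsubseteq> z \<and> x \<noteq> z) \<and> z \<sqsubseteq> y \<and> z \<noteq> y)" "x \<noteq> y"
    using slice_simps(1) by blast+
  then show ?L using R unfolding covers_def lless_slice by blast
qed

lemma rank_function_slice: "rank_function (slice j) \<rho>"
  by (auto simp: rank_function_def bottom_slice covers_slice_iff)

section \<open>Joins and meets in a slice\<close>

text \<open>Since rank is monotone, \<open>T (j + \<rho> s)\<close> is an upper bound of
  \<open>x\<close> and \<open>y\<close>, and so lies above their join \<open>s\<close>.\<close>

lemma join_in_slice:
  assumes x: "x \<in> carrier (slice j)" and y: "y \<in> carrier (slice j)"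
    and s: "is_lub P s {x, y}"
  shows "s \<in> carrier (slice j)"
proof -
  have P: "x \<in> carrier P" "y \<in> carrier P" using x y by auto
  then have sP: "s \<in> carrier P" "x \<sqsubseteq> s" "y \<sqsubseteq> s"
    and least: "\<And>u. \<lbrakk>u \<in> carrier P; x \<sqsubseteq> u; y \<sqsubseteq> u\<rbrakk> \<Longrightarrow> s \<sqsubseteq> u"
    using s by (auto simp: is_lub_pair_iff)
  have "x \<sqsubseteq> T (j + \<rho> s)" "y \<sqsubseteq> T (j + \<rho> s)"
    using x y rank_mono[OF _ sP(1,2)] rank_mono[OF _ sP(1,3)] by (auto intro: le_T_mono)
  then show ?thesis using least sP(1) by simp
qed

lemma join_slice:
  assumes "x \<in> carrier (slice j)" "y \<in> carrier (slice j)"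
  shows "\<exists>s. is_lub (slice j) s {x, y}"
proof -
  have P: "x \<in> carrier P" "y \<in> carrier P" using assms by auto
  obtain s where s: "is_lub P s {x, y}"
    using join_exists[OF P] by blast
  have "is_lub (slice j) s {x, y}"
    using join_in_slice[OF assms s] s unfolding is_lub_pair_iff[OF P] is_lub_pair_iff[OF assms]
    by simp
  then show ?thesis ..
qed

text \<open>A maximal-rank common lower bound absorbs every other one by joining with it.\<close>

lemma meet_slice:
  assumes x: "x \<in> carrier (slice j)" and y: "y \<in> carrier (slice j)"
  shows "\<exists>s. is_glb (slice j) s {x, y}"
proof -
  have P: "x \<in> carrier P" "y \<in> carrier P" using x y by auto
  define A where "A = {u \<in> carrier (slice j). u \<sqsubseteq> x \<and> u \<sqsubseteq> y}"
  have "T 0 \<in> A" using P by (auto simp: A_def T_mono T_0_le)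
  moreover have "\<forall>u. u \<in> A \<longrightarrow> \<rho> u < Suc (\<rho> x)"
    using P(1) rank_mono by (auto simp: A_def less_Suc_eq_le)
  \<comment> \<open>The rank of \<open>x\<close> bounds the ranks in \<open>A\<close>, so a common
    lower bound of greatest rank exists.\<close>
  ultimately obtain l where l: "l \<in> A" and max: "\<And>u. u \<in> A \<Longrightarrow> \<rho> u \<le> \<rho> l"
    using ex_has_greatest_nat[of "\<lambda>u. u \<in> A" "T 0" \<rho> "Suc (\<rho> x)"] by auto
  have "w \<sqsubseteq> l" if w: "w \<in> A" for w
  proof -
    have lw: "l \<in> carrier (slice j)" "w \<in> carrier (slice j)" using l w A_def by auto
    then have lwP: "l \<in> carrier P" "w \<in> carrier P" by auto
    obtain s where s: "is_lub P s {l, w}" using join_exists[OF lwP] by blast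
    note ls = s[unfolded is_lub_pair_iff[OF lwP]]
    have "s \<sqsubseteq> x" "s \<sqsubseteq> y" using ls l w P by (auto simp: A_def)
    then have "\<rho> s \<le> \<rho> l" using max[of s] join_in_slice[OF lw s] by (simp add: A_def)
    then have "l = s" using rank_strict[of l s] ls lwP by auto
    then show ?thesis using ls by simp
  qed
  then have "is_glb (slice j) l {x, y}"
    using l unfolding is_glb_pair_iff[OF x y] by (simp add: A_def)
  then show ?thesis ..
qed

lemma lattice_slice: "lattice (slice j)"
proof -
  interpret Q: partial_order "slice j" by (rule partial_order_slice)
  show ?thesis
    by unfold_locales (use join_slice meet_slice in auto)
qed

section \<open>Maximal chains and finiteness of rank levels\<close>

text \<open>In a chain, rank determines the element. A maximal chain has no last element because
  some \<open>T n\<close> could be added, and no gap because \<open>slice_step_up\<close> would fill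
  it; so every rank occurs exactly once.\<close>

lemma maximal_chain_slice:
  assumes "maximal_chain (slice j) C"
  obtains x where "C = range x" "x 0 = T 0"
    "\<And>i. covers (slice j) (x (Suc i)) (x i)" "\<And>i. \<rho> (x i) = i"
proof -
  have CV: "C \<subseteq> carrier (slice j)"
    and cmp: "\<And>x y. \<lbrakk>x \<in> C; y \<in> C\<rbrakk> \<Longrightarrow> x \<sqsubseteq> y \<or> y \<sqsubseteq> x"
    and ins: "\<And>z. \<lbrakk>z \<in> carrier (slice j); \<And>y. y \<in> C \<Longrightarrow> y \<sqsubseteq> z \<or> z \<sqsubseteq> y\<rbrakk> \<Longrightarrow> z \<in> C"
    using maximal_chainD[OF partial_order_slice assms] unfolding slice_simps(2) by blast+
  have CP: "\<And>x. x \<in> C \<Longrightarrow> x \<in> carrier P" using CV by auto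
  have T0: "T 0 \<in> C" using CP by (intro ins) (auto simp: T_mono T_0_le)
  have inj: "x = y" if "x \<in> C" "y \<in> C" "\<rho> x = \<rho> y" for x y
    using cmp[OF that(1,2)] rank_strict[of x y] rank_strict[of y x] CP that by auto
  have le: "x \<sqsubseteq> y" if "x \<in> C" "y \<in> C" "\<rho> x \<le> \<rho> y" for x y
    using cmp[OF that(1,2)] rank_strict[of y x] CP that by fastforce
  have above: "\<exists>y\<in>C. \<rho> x < \<rho> y" if x: "x \<in> C" for x
  proof (rule ccontr)
    assume "\<not> (\<exists>y\<in>C. \<rho> x < \<rho> y)"
    then have low: "y \<sqsubseteq> x" if "y \<in> C" for y using le[OF that x] that by auto
    \<comment> \<open>An element of greatest rank in \<open>C\<close> bounds \<open>C\<close>, hence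
      \<open>T (Suc n)\<close> is comparable with all of \<open>C\<close> and must belong to it,
      although its rank exceeds that of \<open>x\<close>.\<close>
    obtain n where n: "x \<sqsubseteq> T n" using below_T CP x by blast
    have "y \<sqsubseteq> T (Suc n)" if "y \<in> C" for y
      using le_trans[OF low[OF that] le_T_mono[OF n, of "Suc n"]] CP x that by simp
    then have "T (Suc n) \<in> C" using ins[OF T_in_slice] by blast
    then have "T (Suc n) \<sqsubseteq> T n" using le_trans[OF low n] CP x by simp
    then show False using rank_mono[of "T (Suc n)" "T n"] by simp
  qed
  have "\<exists>x\<in>C. \<rho> x = i" for i
  proof (induction i)
    case 0
    then show ?case using T0 by (intro bexI[of _ "T 0"]) auto
  next
    case (Suc i)
    then obtain x where x: "x \<in> C" "\<rho> x = i" by auto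
    \<comment> \<open>Here \<open>y\<close> is the next element of \<open>C\<close> after
      \<open>x\<close>. Every member of \<open>C\<close> lies above \<open>y\<close> or below
      \<open>x\<close>, so the element \<open>z\<close> one rank above \<open>x\<close> and below
      \<open>y\<close> is comparable with all of \<open>C\<close>.\<close>
    obtain y where y: "y \<in> C" "\<rho> x < \<rho> y"
      and least: "\<And>u. \<lbrakk>u \<in> C; \<rho> x < \<rho> u\<rbrakk> \<Longrightarrow> \<rho> y \<le> \<rho> u"
      using ex_has_least_nat[of "\<lambda>y. y \<in> C \<and> \<rho> x < \<rho> y" _ \<rho>] above[OF x(1)] by blast
    have "x \<sqsubseteq> y" "x \<noteq> y" using le[of x y] x y by auto
    then obtain z where z: "z \<in> carrier (slice j)" "x \<sqsubseteq> z" "z \<sqsubseteq> y" "\<rho> z = Suc (\<rho> x)"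
      using slice_step_up[of x j y] x y CV by blast
    have "u \<sqsubseteq> z \<or> z \<sqsubseteq> u" if u: "u \<in> C" for u
    proof (cases "\<rho> x < \<rho> u")
      case True
      then have "y \<sqsubseteq> u" using le least u y by blast
      then show ?thesis using le_trans[OF z(3)] z(1) CP u y by simp
    next
      case False
      then have "u \<sqsubseteq> x" using le u x by auto
      then show ?thesis using le_trans[OF _ z(2)] z(1) CP u x by simp
    qed
    then have "z \<in> C" using ins z(1) by blast
    then show ?case using z x by auto
  qed
  then obtain c where c: "\<And>i. c i \<in> C" "\<And>i. \<rho> (c i) = i" by metis
  show ?thesis
  proof (rule that)
    have "x = c (\<rho> x)" if "x \<in> C" for x using inj[OF that c(1)] c(2) by simp
    then show "C = range c" using c(1) by blast
    show "c 0 = T 0" using rank_0 c CP by blast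
    show "covers (slice j) (c (Suc i)) (c i)" for i
      unfolding covers_slice_iff
      using c le[of "c i" "c (Suc i)"] subsetD[OF CV c(1)] by (simp del: slice_simps(1))
  qed (rule c(2))
qed

lemma finite_type_N_graded_slice: "finite_type_N_graded (slice j)"
  unfolding finite_type_N_graded_def
proof (intro conjI exI[of _ \<rho>] allI impI)
  show "partial_order (slice j)" by (rule partial_order_slice)
  show "\<exists>b. least (slice j) b (carrier (slice j))" using bottom_slice_least by blast
  show "rank_function (slice j) \<rho>" by (rule rank_function_slice)
  show "\<exists>x. C = range x \<and> x 0 = \<bottom>\<^bsub>slice j\<^esub> \<and> (\<forall>i. covers (slice j) (x (Suc i)) (x i) \<and> \<rho> (x i) = i)"
    if "maximal_chain (slice j) C" for C
    using maximal_chain_slice[OF that] by (metis bottom_slice)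
  \<comment> \<open>The slice condition puts all elements of rank \<open>i\<close> below
    \<open>T (j + i)\<close>, and this ideal is finite.\<close>
  show "finite {x \<in> carrier (slice j). \<rho> x = i}" for i
    by (rule finite_subset[OF _ finite_below[of "j + i"]]) auto
qed

section \<open>Principal filters of a slice\<close>

text \<open>For a rank-one \<open>s\<close> below \<open>p\<close>, the map \<open>\<phi>\<close> of
  \<open>filter_iso\<close> carries the filter above \<open>p\<close> to the filter above
  \<open>\<phi> p\<close>, whose rank is smaller by one. Composing with the isomorphism from the
  induction hypothesis finishes the step.\<close>

lemma order_isomorphic_principal_filter_slice:
  assumes "p \<in> carrier (slice j)"
  shows "order_isomorphic (principal_filter (slice j) p) (slice j)"
  using assms
proof (induction "\<rho> p" arbitrary: p)
  case 0
  then have "p = T 0" using rank_0 by simp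
  then have "principal_filter (slice j) p = slice j"
    using T_0_le by (simp add: principal_filter_def slice_def cong: conj_cong)
  moreover have "order_iso (slice j) (slice j) id"
    using partial_order.axioms(1)[OF partial_order_slice] by (auto simp: order_iso_def order_emb_def)
  ultimately show ?case by (auto simp: order_isomorphic_def)
next
  case (Suc n)
  have pP: "p \<in> carrier P" using Suc.prems by simp
  have "T 0 \<noteq> p" using Suc.hyps(2) by auto
  then obtain s where s: "s \<in> carrier (slice j)" "s \<sqsubseteq> p" "\<rho> s = 1"
    using slice_step_up[OF T_in_slice Suc.prems T_0_le[OF pP]] by auto
  \<comment> \<open>In slice \<open>j\<close>, rank one means lying below \<open>T (Suc j)\<close>;
    this opens the stage clause of \<open>filter_iso\<close> for every
    \<open>T (Suc (j + i))\<close>.\<close>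
  have sP: "s \<in> carrier P" and sT: "s \<sqsubseteq> T (Suc j)" using s by auto
  obtain \<phi> where iso: "order_iso (principal_filter P s) P \<phi>"
    and \<phi>: "\<And>x. \<lbrakk>x \<in> carrier P; s \<sqsubseteq> x\<rbrakk> \<Longrightarrow> \<rho> x = Suc (\<rho> (\<phi> x))"
      "\<And>x n. \<lbrakk>x \<in> carrier P; s \<sqsubseteq> x; s \<sqsubseteq> T (Suc n)\<rbrakk> \<Longrightarrow> x \<sqsubseteq> T (Suc n) \<longleftrightarrow> \<phi> x \<sqsubseteq> T n"
    using filter_iso[OF sP s(3)] by blast
  have bij: "bij_betw \<phi> {q \<in> carrier P. s \<sqsubseteq> q} (carrier P)"
    and emb: "\<And>x y. \<lbrakk>x \<in> carrier P; s \<sqsubseteq> x; y \<in> carrier P; s \<sqsubseteq> y\<rbrakk> \<Longrightarrow> \<phi> x \<sqsubseteq> \<phi> y \<longleftrightarrow> x \<sqsubseteq> y"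
    using iso by (auto simp: order_iso_def order_emb_def principal_filter_def)
  have \<phi>P: "\<phi> x \<in> carrier P" if "x \<in> carrier P" "s \<sqsubseteq> x" for x
    using bij that by (auto dest: bij_betwE)
  \<comment> \<open>Rank and stage drop together: \<open>x\<close> below
    \<open>T (j + \<rho> x)\<close> becomes \<open>\<phi> x\<close> below
    \<open>T (j + \<rho> (\<phi> x))\<close>, so \<open>\<phi>\<close> both preserves and reflects
    the slice.\<close>
  have V: "\<phi> x \<in> carrier (slice j) \<longleftrightarrow> x \<in> carrier (slice j)" if x: "x \<in> carrier P" "s \<sqsubseteq> x" for x
  proof -
    have "s \<sqsubseteq> T (Suc (j + \<rho> (\<phi> x)))" using le_T_mono[OF sT] sP by simp
    then show ?thesis using \<phi>(1)[OF x] \<phi>(2)[OF x, of "j + \<rho> (\<phi> x)"] \<phi>P x by simp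
  qed
  have "\<phi> p \<in> carrier (slice j)" "n = \<rho> (\<phi> p)"
    using V[OF pP s(2)] Suc.prems Suc.hyps(2) \<phi>(1)[OF pP s(2)] by auto
  then obtain \<psi> where \<psi>: "order_iso (principal_filter (slice j) (\<phi> p)) (slice j) \<psi>"
    using Suc.hyps(1) unfolding order_isomorphic_def by blast
  let ?F = "{q \<in> carrier (slice j). p \<sqsubseteq> q}" and ?G = "{q \<in> carrier (slice j). \<phi> p \<sqsubseteq> q}"
  have F: "q \<in> carrier P" "s \<sqsubseteq> q" if "q \<in> ?F" for q
    using that le_trans[OF s(2)] sP pP by auto
  have "\<phi> ` ?F = ?G"
  proof (intro equalityI subsetI)
    fix r assume "r \<in> \<phi> ` ?F"
    then obtain q where q: "q \<in> ?F" "r = \<phi> q" by blast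
    then show "r \<in> ?G" using V[OF F[OF q(1)]] emb[OF pP s(2) F[OF q(1)]] by blast
  next
    fix r assume r: "r \<in> ?G"
    then obtain q where q: "q \<in> carrier P" "s \<sqsubseteq> q" "r = \<phi> q"
      using bij by (auto simp: bij_betw_def)
    then have "q \<in> ?F" using r V[OF q(1,2)] emb[OF pP s(2) q(1,2)] by blast
    then show "r \<in> \<phi> ` ?F" using q(3) by blast
  qed
  moreover have "inj_on \<phi> ?F"
    by (rule inj_on_subset[OF bij_betw_imp_inj_on[OF bij]]) (use F in blast)
  ultimately have bF: "bij_betw \<phi> ?F ?G" by (simp add: bij_betw_def)
  have cf: "carrier (principal_filter (slice j) q) = {r \<in> carrier (slice j). q \<sqsubseteq> r}" for q
    by (simp add: principal_filter_def)
  have wpo: "weak_partial_order (principal_filter (slice j) q)" for q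
    unfolding principal_filter_def
    by (rule weak_partial_order_subset[OF partial_order.axioms(1)[OF partial_order_slice]]) auto
  have "order_iso (principal_filter (slice j) p) (slice j) (\<psi> \<circ> \<phi>)"
    unfolding order_iso_def order_emb_def
  proof (intro conjI ballI)
    show "bij_betw (\<psi> \<circ> \<phi>) (carrier (principal_filter (slice j) p)) (carrier (slice j))"
      unfolding cf by (rule bij_betw_trans[OF bF]) (use \<psi> in \<open>simp add: order_iso_def cf del: slice_simps(1)\<close>)
    fix x y
    assume xy: "x \<in> carrier (principal_filter (slice j) p)" "y \<in> carrier (principal_filter (slice j) p)"
    then have xF: "x \<in> ?F" "y \<in> ?F" unfolding cf .
    then have "\<phi> x \<in> ?G" "\<phi> y \<in> ?G" using \<open>\<phi> ` ?F = ?G\<close> by blast+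
    then have "\<psi> (\<phi> x) \<sqsubseteq> \<psi> (\<phi> y) \<longleftrightarrow> \<phi> x \<sqsubseteq> \<phi> y"
      using \<psi> by (simp add: order_iso_def order_emb_def principal_filter_def)
    then show "(\<psi> \<circ> \<phi>) x \<sqsubseteq>\<^bsub>slice j\<^esub> (\<psi> \<circ> \<phi>) y \<longleftrightarrow> x \<sqsubseteq>\<^bsub>principal_filter (slice j) p\<^esub> y"
      using emb[OF F[OF xF(1)] F[OF xF(2)]] by (simp add: principal_filter_def)
  qed (use wpo partial_order.axioms(1)[OF partial_order_slice] in auto)
  then show ?case by (auto simp: order_isomorphic_def)
qed

theorem upho_lattice_slice: "upho_lattice (slice j)"
  unfolding upho_lattice_def
proof (intro conjI ballI)
  show "\<exists>x\<in>carrier (slice j). \<exists>y\<in>carrier (slice j). x \<noteq> y"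
    using T_in_slice T_inj[of 0 1] by (metis zero_neq_one)
qed (auto intro: lattice_slice finite_type_N_graded_slice order_isomorphic_principal_filter_slice
      simp del: slice_simps(1))

section \<open>The core of a slice\<close>

lemma atoms_slice: "atoms (slice j) = {s \<in> carrier P. \<rho> s = 1 \<and> s \<sqsubseteq> T (Suc j)}"
  by (auto simp: atoms_def bottom_slice covers_slice_iff T_0_le T_mono)

text \<open>\<open>atoms_join\<close> makes \<open>T (Suc j)\<close> the least upper bound in the
  whole poset, and it remains so in the slice because it belongs to the slice.\<close>

lemma sup_atoms_slice: "\<Squnion>\<^bsub>slice j\<^esub>(atoms (slice j)) = T (Suc j)"
proof -
  have "is_lub (slice j) (T (Suc j)) (atoms (slice j))"
    unfolding least_def Upper_def atoms_slice using atoms_join T_mono by auto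
  then show ?thesis
    by (rule partial_order.sup_unique[OF partial_order_slice])
qed

text \<open>Below \<open>T (Suc j)\<close> the slice condition is automatic: positive rank gives
  \<open>Suc j \<le> j + \<rho> x\<close>, and rank zero leaves only the minimum. So the core is the
  full ideal.\<close>

theorem core_slice: "core (slice j) = P\<lparr>carrier := {x \<in> carrier P. x \<sqsubseteq> T (Suc j)}\<rparr>"
proof -
  have "x \<sqsubseteq> T (j + \<rho> x)" if "x \<in> carrier P" "x \<sqsubseteq> T (Suc j)" for x
  proof (cases "\<rho> x = 0")
    case True
    then show ?thesis using rank_0 that T_0_le by simp
  next
    case False
    then show ?thesis using le_T_mono that by simp
  qed
  then have "\<lbrace>T 0..T (Suc j)\<rbrace>\<^bsub>slice j\<^esub> = {x \<in> carrier P. x \<sqsubseteq> T (Suc j)}"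
    by (auto simp: at_least_at_most_iff T_0_le)
  then show ?thesis
    unfolding core_def interval_def bottom_slice sup_atoms_slice by (simp add: slice_def)
qed

end

section \<open>Uniform sequences\<close>

context uniform_sequence
begin

section \<open>Lattice structure and rank of a single \<open>L n\<close>\<close>

lemma L_lattice: "bounded_lattice (L n)"
  and L_finite: "finite (carrier (L n))"
  using graded_L[of n] by (auto simp: n_graded_def)

lemma L_po: "partial_order (L n)"
  using L_lattice unfolding bounded_lattice_def lattice_def upper_semilattice_def by blast

lemma L_fpo: "finite_partial_order (L n)"
  using L_po L_finite by (simp add: finite_partial_order_def finite_partial_order_axioms_def)

lemmas L_wpo = partial_order.axioms(1)[OF L_po]
lemmas L_refl = weak_partial_order.le_refl[OF L_wpo]
lemmas L_trans = weak_partial_order.le_trans[OF L_wpo]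
lemmas L_antisym = partial_order.le_antisym[OF L_po]
lemmas L_lless = partial_order.lless_eq[OF L_po]

lemma L_bottom: "\<bottom>\<^bsub>L n\<^esub> \<in> carrier (L n)" "x \<in> carrier (L n) \<Longrightarrow> \<bottom>\<^bsub>L n\<^esub> \<sqsubseteq>\<^bsub>L n\<^esub> x"
  and L_top: "\<top>\<^bsub>L n\<^esub> \<in> carrier (L n)" "x \<in> carrier (L n) \<Longrightarrow> x \<sqsubseteq>\<^bsub>L n\<^esub> \<top>\<^bsub>L n\<^esub>"
proof -
  interpret bounded_lattice "L n" by (rule L_lattice)
  show "\<bottom>\<^bsub>L n\<^esub> \<in> carrier (L n)" "x \<in> carrier (L n) \<Longrightarrow> \<bottom>\<^bsub>L n\<^esub> \<sqsubseteq>\<^bsub>L n\<^esub> x"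
    "\<top>\<^bsub>L n\<^esub> \<in> carrier (L n)" "x \<in> carrier (L n) \<Longrightarrow> x \<sqsubseteq>\<^bsub>L n\<^esub> \<top>\<^bsub>L n\<^esub>"
    by (rule bottom_closed bottom_lower top_closed top_higher; assumption?)+
qed

lemma L_meet:
  assumes "x \<in> carrier (L n)" "y \<in> carrier (L n)"
  shows "x \<sqinter>\<^bsub>L n\<^esub> y \<in> carrier (L n)" "x \<sqinter>\<^bsub>L n\<^esub> y \<sqsubseteq>\<^bsub>L n\<^esub> x" "x \<sqinter>\<^bsub>L n\<^esub> y \<sqsubseteq>\<^bsub>L n\<^esub> y"
    and "\<lbrakk>z \<sqsubseteq>\<^bsub>L n\<^esub> x; z \<sqsubseteq>\<^bsub>L n\<^esub> y; z \<in> carrier (L n)\<rbrakk> \<Longrightarrow> z \<sqsubseteq>\<^bsub>L n\<^esub> x \<sqinter>\<^bsub>L n\<^esub> y"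
proof -
  interpret bounded_lattice "L n" by (rule L_lattice)
  show "x \<sqinter>\<^bsub>L n\<^esub> y \<in> carrier (L n)" "x \<sqinter>\<^bsub>L n\<^esub> y \<sqsubseteq>\<^bsub>L n\<^esub> x" "x \<sqinter>\<^bsub>L n\<^esub> y \<sqsubseteq>\<^bsub>L n\<^esub> y"
    using meet_closed[OF assms] meet_left[OF assms] meet_right[OF assms] by simp_all
  show "z \<sqsubseteq>\<^bsub>L n\<^esub> x \<sqinter>\<^bsub>L n\<^esub> y" if "z \<sqsubseteq>\<^bsub>L n\<^esub> x" "z \<sqsubseteq>\<^bsub>L n\<^esub> y" "z \<in> carrier (L n)"
    using meet_le[OF that(1,2) assms that(3)] .
qed

lemma L_join:
  assumes "x \<in> carrier (L n)" "y \<in> carrier (L n)"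
  shows "x \<squnion>\<^bsub>L n\<^esub> y \<in> carrier (L n)" "x \<sqsubseteq>\<^bsub>L n\<^esub> x \<squnion>\<^bsub>L n\<^esub> y" "y \<sqsubseteq>\<^bsub>L n\<^esub> x \<squnion>\<^bsub>L n\<^esub> y"
    and "\<lbrakk>x \<sqsubseteq>\<^bsub>L n\<^esub> z; y \<sqsubseteq>\<^bsub>L n\<^esub> z; z \<in> carrier (L n)\<rbrakk> \<Longrightarrow> x \<squnion>\<^bsub>L n\<^esub> y \<sqsubseteq>\<^bsub>L n\<^esub> z"
proof -
  interpret bounded_lattice "L n" by (rule L_lattice)
  show "x \<squnion>\<^bsub>L n\<^esub> y \<in> carrier (L n)" "x \<sqsubseteq>\<^bsub>L n\<^esub> x \<squnion>\<^bsub>L n\<^esub> y" "y \<sqsubseteq>\<^bsub>L n\<^esub> x \<squnion>\<^bsub>L n\<^esub> y"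
    using join_closed[OF assms] join_left[OF assms] join_right[OF assms] by simp_all
  show "x \<squnion>\<^bsub>L n\<^esub> y \<sqsubseteq>\<^bsub>L n\<^esub> z" if "x \<sqsubseteq>\<^bsub>L n\<^esub> z" "y \<sqsubseteq>\<^bsub>L n\<^esub> z" "z \<in> carrier (L n)"
    using join_le[OF that(1,2) assms that(3)] .
qed

lemma top_le_atom_bound:
  assumes "z \<in> carrier (L n)" "\<And>a. a \<in> atoms (L n) \<Longrightarrow> a \<sqsubseteq>\<^bsub>L n\<^esub> z"
  shows "\<top>\<^bsub>L n\<^esub> \<sqsubseteq>\<^bsub>L n\<^esub> z"
proof -
  obtain A where A: "A \<subseteq> atoms (L n)" "\<top>\<^bsub>L n\<^esub> = \<Squnion>\<^bsub>L n\<^esub>A"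
    using geometric_L[of n] L_top(1) unfolding geometric_def atomic_def by blast
  have AL: "A \<subseteq> carrier (L n)" using A(1) by (auto simp: atoms_def covers_def)
  interpret bounded_lattice "L n" by (rule L_lattice)
  have "is_lub (L n) (\<Squnion>\<^bsub>L n\<^esub>A) A"
  proof (cases "A = {}")
    \<comment> \<open>The empty set occurs for the one-point lattice \<open>L 0\<close>, which has
      no atoms. Every element is an upper bound of it, so its supremum is the bottom.\<close>
    case True
    then show ?thesis
      unfolding sup_def using bottom_least[unfolded bottom_def] by simp
  next
    case False
    then show ?thesis
      using finite_sup_least[OF finite_subset[OF AL L_finite] AL] by simp
  qed
  moreover have "z \<in> Upper (L n) A"
    using assms A(1) by (auto simp: Upper_def)
  ultimately show ?thesis unfolding A(2) by (rule least_le)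
qed

lemma rank_L: "rank_function (L n) (rank (L n))"
  by (rule rank_function_rank[OF graded_L])

lemma rank_bottom: "rank (L n) \<bottom>\<^bsub>L n\<^esub> = 0"
  and rank_covers: "covers (L n) y x \<Longrightarrow> rank (L n) y = Suc (rank (L n) x)"
  using rank_L[of n] by (auto simp: rank_function_def)

lemma rank_less:
  assumes "x \<in> carrier (L n)" "y \<in> carrier (L n)" "x \<sqsubseteq>\<^bsub>L n\<^esub> y" "x \<noteq> y"
  shows "rank (L n) x < rank (L n) y"
  by (rule finite_partial_order.rank_function_strict_mono[OF L_fpo rank_L])
    (use assms L_lless in auto)

lemma rank_shift:
  assumes "\<And>x y. covers (L n) y x \<Longrightarrow> covers (L m) (f y) (f x)" "x \<in> carrier (L n)"
  shows "rank (L m) (f x) = rank (L m) (f \<bottom>\<^bsub>L n\<^esub>) + rank (L n) x"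
  by (rule finite_partial_order.rank_function_shift[OF L_fpo rank_L rank_L _ assms])
    (use L_bottom in \<open>auto simp: least_def\<close>)

lemma L_cover_below:
  assumes "x \<in> carrier (L n)" "y \<in> carrier (L n)" "x \<sqsubseteq>\<^bsub>L n\<^esub> y" "x \<noteq> y"
  obtains z where "z \<in> carrier (L n)" "covers (L n) y z" "x \<sqsubseteq>\<^bsub>L n\<^esub> z"
proof -
  have "x \<sqsubset>\<^bsub>L n\<^esub> y" using assms L_lless by simp
  from finite_partial_order.cover_below[OF L_fpo assms(1,2) this]
  show ?thesis using that by (metis covers_def)
qed

text \<open>A lower cover of an element of rank one has rank zero and is therefore the bottom. Since
  the transition maps preserve rank, atoms can be recognized in the limit by rank one.\<close>

lemma atoms_iff_rank: "a \<in> atoms (L n) \<longleftrightarrow> a \<in> carrier (L n) \<and> rank (L n) a = 1"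
proof
  assume "a \<in> atoms (L n)"
  then show "a \<in> carrier (L n) \<and> rank (L n) a = 1"
    using rank_covers rank_bottom by (auto simp: atoms_def covers_def)
next
  assume a: "a \<in> carrier (L n) \<and> rank (L n) a = 1"
  then have "\<bottom>\<^bsub>L n\<^esub> \<noteq> a" using rank_bottom[of n] by auto
  then obtain z where z: "z \<in> carrier (L n)" "covers (L n) a z"
    using L_cover_below L_bottom a by metis
  then have "rank (L n) z = 0" using rank_covers[of n a z] a by simp
  then have "z = \<bottom>\<^bsub>L n\<^esub>"
    using rank_less[of "\<bottom>\<^bsub>L n\<^esub>" n z] z(1) L_bottom by fastforce
  then show "a \<in> atoms (L n)" using z by (simp add: atoms_def)
qed

section \<open>The embeddings \<open>\<iota>\<close> and the modular coatoms\<close>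

lemma iota_in: "x \<in> carrier (L n) \<Longrightarrow> \<iota> n x \<in> carrier (L (Suc n))"
  using iota_closed by blast

lemma iota_le: "\<lbrakk>x \<in> carrier (L n); y \<in> carrier (L n)\<rbrakk> \<Longrightarrow>
    \<iota> n x \<sqsubseteq>\<^bsub>L (Suc n)\<^esub> \<iota> n y \<longleftrightarrow> x \<sqsubseteq>\<^bsub>L n\<^esub> y"
  using iota_emb unfolding order_emb_def by blast

lemma iota_inj: "\<lbrakk>x \<in> carrier (L n); y \<in> carrier (L n); \<iota> n x = \<iota> n y\<rbrakk> \<Longrightarrow> x = y"
  by (metis L_antisym L_refl iota_in iota_le)

lemma t_in: "t n \<in> carrier (L (Suc n))"
  using t_coatom by (auto simp: coatoms_def covers_def)

lemma iota_le_t: "x \<in> carrier (L n) \<Longrightarrow> \<iota> n x \<sqsubseteq>\<^bsub>L (Suc n)\<^esub> t n"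
  using imageI[of x "carrier (L n)" "\<iota> n"] unfolding iota_image at_least_at_most_iff by simp

lemma le_t_imp_iota:
  assumes "y \<in> carrier (L (Suc n))" "y \<sqsubseteq>\<^bsub>L (Suc n)\<^esub> t n"
  obtains x where "x \<in> carrier (L n)" "y = \<iota> n x"
proof -
  have "y \<in> \<iota> n ` carrier (L n)"
    unfolding iota_image at_least_at_most_iff using assms L_bottom(2) by simp
  then show ?thesis using that by (elim imageE)
qed

lemma iota_bottom: "\<iota> n \<bottom>\<^bsub>L n\<^esub> = \<bottom>\<^bsub>L (Suc n)\<^esub>"
proof -
  obtain a where a: "a \<in> carrier (L n)" "\<bottom>\<^bsub>L (Suc n)\<^esub> = \<iota> n a"
    using le_t_imp_iota[OF L_bottom(1) L_bottom(2)[OF t_in]] .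
  then have "\<iota> n \<bottom>\<^bsub>L n\<^esub> \<sqsubseteq>\<^bsub>L (Suc n)\<^esub> \<bottom>\<^bsub>L (Suc n)\<^esub>"
    using iota_le[OF L_bottom(1) a(1)] L_bottom(2)[OF a(1)] by simp
  then show ?thesis
    by (rule L_antisym[OF _ L_bottom(2)]) (rule L_bottom(1) iota_in)+
qed

lemma iota_top: "\<iota> n \<top>\<^bsub>L n\<^esub> = t n"
proof -
  obtain a where a: "a \<in> carrier (L n)" "t n = \<iota> n a"
    using le_t_imp_iota[OF t_in L_refl[OF t_in]] .
  then have "t n \<sqsubseteq>\<^bsub>L (Suc n)\<^esub> \<iota> n \<top>\<^bsub>L n\<^esub>"
    using iota_le[OF a(1) L_top(1)] L_top(2)[OF a(1)] by simp
  moreover have "\<iota> n \<top>\<^bsub>L n\<^esub> \<sqsubseteq>\<^bsub>L (Suc n)\<^esub> t n"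
    by (rule iota_le_t[OF L_top(1)])
  ultimately show ?thesis
    by (rule L_antisym[OF _ _ iota_in[OF L_top(1)] t_in, rotated])
qed

text \<open>The image of \<open>\<iota> n\<close> is a lower interval, so whatever lies between two
  images is itself an image and can be pulled back.\<close>

lemma iota_covers:
  assumes "covers (L n) y x"
  shows "covers (L (Suc n)) (\<iota> n y) (\<iota> n x)"
proof -
  have xy: "x \<in> carrier (L n)" "y \<in> carrier (L n)" "x \<sqsubseteq>\<^bsub>L n\<^esub> y" "x \<noteq> y"
    and no: "\<And>z. \<lbrakk>z \<in> carrier (L n); x \<sqsubseteq>\<^bsub>L n\<^esub> z; z \<sqsubseteq>\<^bsub>L n\<^esub> y\<rbrakk> \<Longrightarrow> x = z \<or> z = y"
    using assms unfolding covers_def L_lless by blast+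
  have "\<iota> n x = z \<or> z = \<iota> n y"
    if z: "z \<in> carrier (L (Suc n))" "\<iota> n x \<sqsubseteq>\<^bsub>L (Suc n)\<^esub> z" "z \<sqsubseteq>\<^bsub>L (Suc n)\<^esub> \<iota> n y" for z
  proof -
    have "z \<sqsubseteq>\<^bsub>L (Suc n)\<^esub> t n"
      using L_trans[OF z(3) iota_le_t[OF xy(2)] z(1) iota_in[OF xy(2)] t_in] .
    from le_t_imp_iota[OF z(1) this]
    obtain w where "w \<in> carrier (L n)" "z = \<iota> n w" .
    then show ?thesis using no[of w] z xy iota_le by blast
  qed
  then show ?thesis
    unfolding covers_def L_lless using xy iota_in iota_le iota_inj by metis
qed

lemma rank_iota: "x \<in> carrier (L n) \<Longrightarrow> rank (L (Suc n)) (\<iota> n x) = rank (L n) x"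
  using rank_shift[where n = n and m = "Suc n" and f = "\<iota> n", OF iota_covers] by (simp add: iota_bottom rank_bottom)

text \<open>The coatom \<open>t n\<close> is the image of the top of \<open>L n\<close>, so the rank
  of the top grows by one from each lattice to the next.\<close>

lemma rank_top_L: "rank (L n) \<top>\<^bsub>L n\<^esub> = n"
proof (induction n)
  case 0
  \<comment> \<open>By \<open>graded_L\<close> a maximal chain of \<open>L 0\<close> has a single
    element; it contains bottom and top, so they coincide.\<close>
  obtain C where C: "maximal_chain (L 0) C"
    unfolding maximal_chain_def using pred_on.Hausdorff by blast
  then have "card C = 1" using graded_L[of 0] by (simp add: n_graded_def)
  moreover have "\<bottom>\<^bsub>L 0\<^esub> \<in> C"
    using maximal_chainD(1,3)[OF L_po C] L_bottom by (meson subsetD)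
  moreover have "\<top>\<^bsub>L 0\<^esub> \<in> C"
    using maximal_chainD(1,3)[OF L_po C] L_top by (meson subsetD)
  ultimately show ?case using rank_bottom[of 0] by (metis card_1_singletonE singletonD)
next
  case (Suc n)
  have "rank (L (Suc n)) \<top>\<^bsub>L (Suc n)\<^esub> = Suc (rank (L (Suc n)) (t n))"
    using t_coatom[of n] rank_covers by (simp add: coatoms_def)
  then show ?case using rank_iota[OF L_top(1), of n] Suc by (simp add: iota_top)
qed

text \<open>Here \<open>x \<squnion> t n = \<top>\<close>, since \<open>t n\<close> is a coatom not above \<open>x\<close>.\<close>

lemma rank_modular_meet:
  assumes x: "x \<in> carrier (L (Suc n))" and nle: "\<not> x \<sqsubseteq>\<^bsub>L (Suc n)\<^esub> t n"
  shows "rank (L (Suc n)) x = Suc (rank (L (Suc n)) (t n \<sqinter>\<^bsub>L (Suc n)\<^esub> x))"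
proof -
  have cov: "covers (L (Suc n)) \<top>\<^bsub>L (Suc n)\<^esub> (t n)"
    using t_coatom by (simp add: coatoms_def)
  have "t n \<squnion>\<^bsub>L (Suc n)\<^esub> x = \<top>\<^bsub>L (Suc n)\<^esub>"
    using cov L_join[OF t_in x] nle L_top unfolding covers_def L_lless by metis
  then show ?thesis
    using bspec[OF conjunct2[OF t_modular[of n, unfolded modular_element_def]] x] rank_covers[OF cov]
    by simp
qed

section \<open>The isomorphisms \<open>\<theta>\<close>\<close>

lemma
  assumes s: "s \<in> atoms (L (Suc n))"
  shows theta_bij: "bij_betw (\<theta> (Suc n) s) {x \<in> carrier (L (Suc n)). s \<sqsubseteq>\<^bsub>L (Suc n)\<^esub> x} (carrier (L n))"
    and theta_le: "\<lbrakk>x \<in> carrier (L (Suc n)); s \<sqsubseteq>\<^bsub>L (Suc n)\<^esub> x; y \<in> carrier (L (Suc n)); s \<sqsubseteq>\<^bsub>L (Suc n)\<^esub> y\<rbrakk> \<Longrightarrow>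
      \<theta> (Suc n) s x \<sqsubseteq>\<^bsub>L n\<^esub> \<theta> (Suc n) s y \<longleftrightarrow> x \<sqsubseteq>\<^bsub>L (Suc n)\<^esub> y"
proof -
  have "carrier (interval (L (Suc n)) s \<top>\<^bsub>L (Suc n)\<^esub>) = {x \<in> carrier (L (Suc n)). s \<sqsubseteq>\<^bsub>L (Suc n)\<^esub> x}"
    using L_top(2) by (auto simp: interval_def at_least_at_most_iff)
  then show "bij_betw (\<theta> (Suc n) s) {x \<in> carrier (L (Suc n)). s \<sqsubseteq>\<^bsub>L (Suc n)\<^esub> x} (carrier (L n))"
    and "\<lbrakk>x \<in> carrier (L (Suc n)); s \<sqsubseteq>\<^bsub>L (Suc n)\<^esub> x; y \<in> carrier (L (Suc n)); s \<sqsubseteq>\<^bsub>L (Suc n)\<^esub> y\<rbrakk> \<Longrightarrow>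
      \<theta> (Suc n) s x \<sqsubseteq>\<^bsub>L n\<^esub> \<theta> (Suc n) s y \<longleftrightarrow> x \<sqsubseteq>\<^bsub>L (Suc n)\<^esub> y"
    using theta_iso[OF s] unfolding order_iso_def order_emb_def
    by (simp_all add: interval_def)
qed

lemma theta_in:
  assumes "s \<in> atoms (L (Suc n))" "x \<in> carrier (L (Suc n))" "s \<sqsubseteq>\<^bsub>L (Suc n)\<^esub> x"
  shows "\<theta> (Suc n) s x \<in> carrier (L n)"
  using bij_betwE[OF theta_bij[OF assms(1)]] assms by blast

text \<open>The filter above \<open>s\<close> is convex, so the inverse \<open>g\<close> of
  \<open>\<theta>\<close> preserves covers. It sends the bottom to \<open>s\<close>, and the shift
  is the rank of \<open>s\<close>, which is one.\<close>

lemma rank_theta: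
  assumes s: "s \<in> atoms (L (Suc n))" and x: "x \<in> carrier (L (Suc n))" "s \<sqsubseteq>\<^bsub>L (Suc n)\<^esub> x"
  shows "rank (L (Suc n)) x = Suc (rank (L n) (\<theta> (Suc n) s x))"
proof -
  let ?F = "{x \<in> carrier (L (Suc n)). s \<sqsubseteq>\<^bsub>L (Suc n)\<^esub> x}"
  define g where "g = inv_into ?F (\<theta> (Suc n) s)"
  have sL: "s \<in> carrier (L (Suc n))" using s atoms_iff_rank by blast
  have g: "g a \<in> carrier (L (Suc n))" "s \<sqsubseteq>\<^bsub>L (Suc n)\<^esub> g a" "\<theta> (Suc n) s (g a) = a"
    if "a \<in> carrier (L n)" for a
    using theta_bij[OF s] that unfolding g_def bij_betw_def
    by (metis (no_types, lifting) inv_into_into mem_Collect_eq f_inv_into_f)+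
  have g\<theta>: "g (\<theta> (Suc n) s y) = y" if "y \<in> carrier (L (Suc n))" "s \<sqsubseteq>\<^bsub>L (Suc n)\<^esub> y" for y
    using bij_betw_inv_into_left[OF theta_bij[OF s]] that by (simp add: g_def)
  have g_le: "g a \<sqsubseteq>\<^bsub>L (Suc n)\<^esub> g b \<longleftrightarrow> a \<sqsubseteq>\<^bsub>L n\<^esub> b" if "a \<in> carrier (L n)" "b \<in> carrier (L n)" for a b
    using theta_le[OF s g(1,2)[OF that(1)] g(1,2)[OF that(2)]] g(3) that by simp
  have g_covers: "covers (L (Suc n)) (g b) (g a)" if "covers (L n) b a" for a b
  proof -
    have ab: "a \<in> carrier (L n)" "b \<in> carrier (L n)" "a \<sqsubseteq>\<^bsub>L n\<^esub> b" "a \<noteq> b"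
      and no: "\<And>z. \<lbrakk>z \<in> carrier (L n); a \<sqsubseteq>\<^bsub>L n\<^esub> z; z \<sqsubseteq>\<^bsub>L n\<^esub> b\<rbrakk> \<Longrightarrow> a = z \<or> z = b"
      using that unfolding covers_def L_lless by blast+
    have "g a = z \<or> z = g b"
      if z: "z \<in> carrier (L (Suc n))" "g a \<sqsubseteq>\<^bsub>L (Suc n)\<^esub> z" "z \<sqsubseteq>\<^bsub>L (Suc n)\<^esub> g b" for z
    proof -
      have sz: "s \<sqsubseteq>\<^bsub>L (Suc n)\<^esub> z"
        using L_trans[OF g(2)[OF ab(1)] z(2) sL g(1)[OF ab(1)] z(1)] .
      have "z = g (\<theta> (Suc n) s z)" using g\<theta>[OF z(1) sz] by simp
      then show ?thesis
        using no[OF theta_in[OF s z(1) sz]] g_le ab theta_in[OF s z(1) sz] z(2,3) by metis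
    qed
    moreover have "g a \<noteq> g b" using g(3) ab by metis
    ultimately show ?thesis
      unfolding covers_def L_lless using g(1) g_le ab by blast
  qed
  have "rank (L (Suc n)) x = rank (L (Suc n)) (g \<bottom>\<^bsub>L n\<^esub>) + rank (L n) (\<theta> (Suc n) s x)"
    using rank_shift[where f = g, OF g_covers theta_in[OF s x]] g\<theta>[OF x] by simp
  moreover have "g \<bottom>\<^bsub>L n\<^esub> = s"
  proof (rule L_antisym)
    have "\<theta> (Suc n) s s \<in> carrier (L n)" using theta_in[OF s sL] L_refl[OF sL] by blast
    then show "g \<bottom>\<^bsub>L n\<^esub> \<sqsubseteq>\<^bsub>L (Suc n)\<^esub> s"
      using g_le[OF L_bottom(1)] L_bottom(2) g\<theta>[OF sL] L_refl[OF sL] by metis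
    show "s \<sqsubseteq>\<^bsub>L (Suc n)\<^esub> g \<bottom>\<^bsub>L n\<^esub>" "g \<bottom>\<^bsub>L n\<^esub> \<in> carrier (L (Suc n))"
      by (rule g(2) g(1), rule L_bottom(1))+
  qed (rule sL)
  ultimately show ?thesis using s atoms_iff_rank by simp
qed

section \<open>The direct limit\<close>

text \<open>\<open>up d n\<close> is the transition map from \<open>L n\<close> to
  \<open>L (n + d)\<close>.\<close>

primrec up :: "nat \<Rightarrow> nat \<Rightarrow> 'a \<Rightarrow> 'a" where
  "up 0 n x = x"
| "up (Suc d) n x = \<iota> (n + d) (up d n x)"

lemma up_in: "x \<in> carrier (L n) \<Longrightarrow> up d n x \<in> carrier (L (n + d))"
  by (induction d) (simp_all add: iota_in)

lemma up_le: "\<lbrakk>x \<in> carrier (L n); y \<in> carrier (L n)\<rbrakk> \<Longrightarrow>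
    up d n x \<sqsubseteq>\<^bsub>L (n + d)\<^esub> up d n y \<longleftrightarrow> x \<sqsubseteq>\<^bsub>L n\<^esub> y"
  by (induction d) (simp_all add: iota_le up_in)

lemma up_inj: "\<lbrakk>x \<in> carrier (L n); y \<in> carrier (L n); up d n x = up d n y\<rbrakk> \<Longrightarrow> x = y"
  by (metis L_antisym L_refl up_in up_le)

lemma up_Suc_iota: "up (Suc d) n x = up d (Suc n) (\<iota> n x)"
  by (induction d) simp_all

lemma rank_up: "x \<in> carrier (L n) \<Longrightarrow> rank (L (n + d)) (up d n x) = rank (L n) x"
  by (induction d) (simp_all add: rank_iota up_in)

definition cls :: "nat \<Rightarrow> 'a \<Rightarrow> (nat \<times> 'a) set" where
  "cls n x = {q. equivclp (limit_step L \<iota>) (n, x) q}"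

definition stage :: "nat \<Rightarrow> (nat \<times> 'a) set set" where
  "stage n = cls n ` carrier (L n)"

abbreviation lim :: "(nat \<times> 'a) set gorder" where
  "lim \<equiv> direct_limit L \<iota>"

lemma carrier_lim: "carrier lim = (\<Union>n. stage n)"
  by (auto simp: direct_limit_def quotient_def stage_def cls_def)

lemma le_lim: "X \<sqsubseteq>\<^bsub>lim\<^esub> Y \<longleftrightarrow> (\<exists>n x y. (n, x) \<in> X \<and> (n, y) \<in> Y \<and> x \<sqsubseteq>\<^bsub>L n\<^esub> y)"
  and eq_lim: "eq lim = (=)"
  by (simp_all add: direct_limit_def)

lemma cls_refl: "(n, x) \<in> cls n x"
  by (simp add: cls_def)

lemma cls_eq: "q \<in> cls n x \<Longrightarrow> q = (m, y) \<Longrightarrow> cls m y = cls n x"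
  unfolding cls_def by (auto intro: equivclp_trans equivclp_sym)

lemma cls_iota: "x \<in> carrier (L n) \<Longrightarrow> cls (Suc n) (\<iota> n x) = cls n x"
  by (rule cls_eq[OF _ HOL.refl]) (auto simp: cls_def limit_step_def)

lemma cls_up: "x \<in> carrier (L n) \<Longrightarrow> cls (n + d) (up d n x) = cls n x"
  by (induction d) (simp_all add: cls_iota up_in)

text \<open>The generated equivalence amounts to becoming equal at a later stage. Along a zigzag of
  \<open>limit_step\<close>s, a forward step raises \<open>d\<close> by one and a backward step
  raises \<open>e\<close> by one.\<close>

lemma mem_cls:
  assumes "(m, y) \<in> cls n x" "x \<in> carrier (L n)"
  shows "y \<in> carrier (L m)" "\<exists>d e. n + d = m + e \<and> up d n x = up e m y"
proof -
  have "snd q \<in> carrier (L (fst q)) \<and> (\<exists>d e. n + d = fst q + e \<and> up d n x = up e (fst q) (snd q))"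
    if "equivclp (limit_step L \<iota>) (n, x) q" for q
    using that
  proof (induction rule: equivclp_induct)
    case base
    then show ?case using assms(2) by auto
  next
    case (step q r)
    obtain d e where de: "n + d = fst q + e" "up d n x = up e (fst q) (snd q)"
      using step.IH by blast
    from step.hyps(2) show ?case
    proof
      assume "limit_step L \<iota> q r"
      then obtain m y where q: "q = (m, y)" "r = (Suc m, \<iota> m y)" "y \<in> carrier (L m)"
        by (auto simp: limit_step_def)
      have "up (Suc d) n x = up e (Suc m) (\<iota> m y)"
        using de q up_Suc_iota[of e m y] by simp
      then show ?thesis using q iota_in de(1)
        by (intro conjI exI[of _ "Suc d"] exI[of _ e]) simp_all
    next
      assume "limit_step L \<iota> r q"
      then obtain m y where q: "r = (m, y)" "q = (Suc m, \<iota> m y)" "y \<in> carrier (L m)"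
        by (auto simp: limit_step_def)
      have "up d n x = up (Suc e) m y"
        using de q up_Suc_iota[of e m y] by simp
      then show ?thesis using q de(1)
        by (intro conjI exI[of _ d] exI[of _ "Suc e"]) simp_all
    qed
  qed
  from this[of "(m, y)"] show "y \<in> carrier (L m)" "\<exists>d e. n + d = m + e \<and> up d n x = up e m y"
    using assms(1) by (simp_all add: cls_def)
qed

lemma cls_inj:
  assumes "x \<in> carrier (L n)" "y \<in> carrier (L n)" "cls n x = cls n y"
  shows "x = y"
proof -
  have "(n, y) \<in> cls n x" using cls_refl assms(3) by simp
  then obtain d e where "n + d = n + e" "up d n x = up e n y"
    using mem_cls(2) assms(1) by blast
  then show ?thesis using up_inj assms by simp
qed

text \<open>The order of the limit may be witnessed at another stage \<open>m\<close>. At the common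
  stage \<open>n + m\<close> representatives of the same class coincide, and the transition maps
  reflect the order back to stage \<open>n\<close>.\<close>

lemma cls_le:
  assumes x: "x \<in> carrier (L n)" and y: "y \<in> carrier (L n)"
  shows "cls n x \<sqsubseteq>\<^bsub>lim\<^esub> cls n y \<longleftrightarrow> x \<sqsubseteq>\<^bsub>L n\<^esub> y"
proof
  assume "cls n x \<sqsubseteq>\<^bsub>lim\<^esub> cls n y"
  then obtain m x' y' where m: "(m, x') \<in> cls n x" "(m, y') \<in> cls n y" "x' \<sqsubseteq>\<^bsub>L m\<^esub> y'"
    unfolding le_lim by blast
  have up_eq: "up m n z = up n m z'" if "(m, z') \<in> cls n z" "z \<in> carrier (L n)" for z z'
  proof (rule cls_inj[where n = "n + m"])
    have z': "z' \<in> carrier (L m)" using mem_cls(1)[OF that] .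
    then show "up m n z \<in> carrier (L (n + m))" "up n m z' \<in> carrier (L (n + m))"
      using up_in[OF that(2), of m] up_in[OF z', of n] by (simp_all add: add.commute)
    show "cls (n + m) (up m n z) = cls (n + m) (up n m z')"
      using cls_up[OF that(2), of m] cls_up[OF z', of n] cls_eq[OF that(1) HOL.refl]
      by (simp add: add.commute)
  qed
  have "up n m x' \<sqsubseteq>\<^bsub>L (m + n)\<^esub> up n m y'"
    using up_le[OF mem_cls(1)[OF m(1) x] mem_cls(1)[OF m(2) y]] m(3) by simp
  then have "up m n x \<sqsubseteq>\<^bsub>L (n + m)\<^esub> up m n y"
    using up_eq[OF m(1) x] up_eq[OF m(2) y] by (simp add: add.commute)
  then show "x \<sqsubseteq>\<^bsub>L n\<^esub> y" using up_le[OF x y] by simp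
next
  assume "x \<sqsubseteq>\<^bsub>L n\<^esub> y"
  then show "cls n x \<sqsubseteq>\<^bsub>lim\<^esub> cls n y"
    unfolding le_lim using cls_refl by blast
qed

section \<open>Stages as principal ideals\<close>

lemma cls_in_stage: "x \<in> carrier (L n) \<Longrightarrow> cls n x \<in> stage n"
  by (simp add: stage_def)

lemma stage_cases:
  assumes "X \<in> stage n"
  obtains x where "x \<in> carrier (L n)" "X = cls n x"
  using assms unfolding stage_def by blast

lemma stage_subset_lim: "stage n \<subseteq> carrier lim"
  unfolding carrier_lim by blast

lemma cls_in_lim: "x \<in> carrier (L n) \<Longrightarrow> cls n x \<in> carrier lim"
  using cls_in_stage stage_subset_lim by blast

lemma stage_mono:
  assumes "m \<le> n"
  shows "stage m \<subseteq> stage n"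
proof
  fix X assume "X \<in> stage m"
  then obtain x where x: "x \<in> carrier (L m)" "X = cls m x" by (rule stage_cases)
  then show "X \<in> stage n"
    using cls_in_stage[OF up_in[OF x(1), of "n - m"]] cls_up[OF x(1), of "n - m"] assms by simp
qed

lemma lim_in_stage: "X \<in> carrier lim \<Longrightarrow> \<exists>n. X \<in> stage n"
  unfolding carrier_lim by blast

lemma lim_common:
  assumes "X \<in> carrier lim" "Y \<in> carrier lim" "Z \<in> carrier lim"
  obtains n where "X \<in> stage n" "Y \<in> stage n" "Z \<in> stage n"
proof -
  obtain a b c where abc: "X \<in> stage a" "Y \<in> stage b" "Z \<in> stage c"
    using assms[THEN lim_in_stage] by (elim exE)
  show ?thesis
  proof (rule that)
    let ?n = "a + b + c"
    show "X \<in> stage ?n" "Y \<in> stage ?n" "Z \<in> stage ?n"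
      using abc stage_mono[of a ?n] stage_mono[of b ?n] stage_mono[of c ?n] by (simp_all add: subset_iff)
  qed
qed

lemma lim_common2:
  assumes "X \<in> carrier lim" "Y \<in> carrier lim"
  obtains n where "X \<in> stage n" "Y \<in> stage n"
  using lim_common[OF assms assms(2)] .

lemma lim_po: "partial_order lim"
proof
  show "X \<sqsubseteq>\<^bsub>lim\<^esub> X" if "X \<in> carrier lim" for X
    using lim_in_stage[OF that] by (metis stage_cases L_refl cls_le)
  show "X .=\<^bsub>lim\<^esub> Y" if "X \<sqsubseteq>\<^bsub>lim\<^esub> Y" "Y \<sqsubseteq>\<^bsub>lim\<^esub> X" and XY: "X \<in> carrier lim" "Y \<in> carrier lim" for X Y
  proof -
    obtain n where "X \<in> stage n" "Y \<in> stage n" using lim_common2[OF XY] .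
    then obtain x y where "x \<in> carrier (L n)" "X = cls n x" "y \<in> carrier (L n)" "Y = cls n y"
      by (metis stage_cases)
    then show ?thesis using that(1,2) cls_le L_antisym[where n = n and x = x and y = y] by (simp add: eq_lim)
  qed
  show "X \<sqsubseteq>\<^bsub>lim\<^esub> Z" if "X \<sqsubseteq>\<^bsub>lim\<^esub> Y" "Y \<sqsubseteq>\<^bsub>lim\<^esub> Z"
    and XYZ: "X \<in> carrier lim" "Y \<in> carrier lim" "Z \<in> carrier lim" for X Y Z
  proof -
    obtain n where "X \<in> stage n" "Y \<in> stage n" "Z \<in> stage n" using lim_common[OF XYZ] .
    then obtain x y z where xyz: "x \<in> carrier (L n)" "X = cls n x" "y \<in> carrier (L n)" "Y = cls n y"
      "z \<in> carrier (L n)" "Z = cls n z"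
      by (metis stage_cases)
    have "x \<sqsubseteq>\<^bsub>L n\<^esub> y" "y \<sqsubseteq>\<^bsub>L n\<^esub> z" using that(1,2) xyz cls_le by simp_all
    from L_trans[OF this xyz(1,3,5)] show ?thesis using xyz cls_le by simp
  qed
qed (simp_all add: eq_lim)

lemmas lim_wpo = partial_order.axioms(1)[OF lim_po]
lemmas lim_refl = weak_partial_order.le_refl[OF lim_wpo]
lemmas lim_trans = weak_partial_order.le_trans[OF lim_wpo]
lemmas lim_antisym = partial_order.le_antisym[OF lim_po]

definition stage_top :: "nat \<Rightarrow> (nat \<times> 'a) set" where
  "stage_top n = cls n \<top>\<^bsub>L n\<^esub>"

lemma top_in_stage: "stage_top n \<in> stage n"
  by (simp add: stage_top_def cls_in_stage L_top)

lemma top_in_lim: "stage_top n \<in> carrier lim"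
  using top_in_stage stage_subset_lim by blast

lemma stage_le_top: "X \<in> stage n \<Longrightarrow> X \<sqsubseteq>\<^bsub>lim\<^esub> stage_top n"
  by (elim stage_cases) (simp add: stage_top_def cls_le L_top)

lemma stage_top_eq_t: "stage_top n = cls (Suc n) (t n)"
  unfolding stage_top_def using cls_iota[OF L_top(1), of n] iota_top by simp

lemma le_top_in_stage_Suc:
  assumes "X \<in> stage (Suc n)" "X \<sqsubseteq>\<^bsub>lim\<^esub> stage_top n"
  shows "X \<in> stage n"
proof -
  obtain x where x: "x \<in> carrier (L (Suc n))" "X = cls (Suc n) x"
    using assms(1) by (rule stage_cases)
  then have "x \<sqsubseteq>\<^bsub>L (Suc n)\<^esub> t n"
    using assms(2) cls_le[OF x(1) t_in] by (simp add: stage_top_eq_t)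
  from le_t_imp_iota[OF x(1) this] obtain y where "y \<in> carrier (L n)" "x = \<iota> n y" .
  then show ?thesis using x(2) cls_iota cls_in_stage by simp
qed

text \<open>At stage \<open>n + d + 1\<close>, an element below \<open>stage_top (n + d)\<close>
  comes from stage \<open>n + d\<close>, since the image of \<open>\<iota>\<close> is a lower
  interval; repeating this leads down to stage \<open>n\<close>. Thus belonging to a stage becomes
  an order condition.\<close>

lemma stage_iff_le_top: "X \<in> stage n \<longleftrightarrow> X \<in> carrier lim \<and> X \<sqsubseteq>\<^bsub>lim\<^esub> stage_top n"
proof (intro iffI conjI)
  assume X: "X \<in> carrier lim \<and> X \<sqsubseteq>\<^bsub>lim\<^esub> stage_top n"
  have "X \<in> stage n" if "X \<in> stage (n + d)" for d
    using that
  proof (induction d)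
    case (Suc d)
    have "stage_top n \<sqsubseteq>\<^bsub>lim\<^esub> stage_top (n + d)"
      by (rule stage_le_top) (use top_in_stage[of n] stage_mono[of n "n + d"] in auto)
    then have "X \<sqsubseteq>\<^bsub>lim\<^esub> stage_top (n + d)"
      using lim_trans[where x = X and y = "stage_top n" and z = "stage_top (n + d)"] X top_in_lim by simp
    then show ?case using le_top_in_stage_Suc Suc by simp
  qed simp
  moreover obtain m where "X \<in> stage m"
    using lim_in_stage X by blast
  then have "X \<in> stage (n + m)" using stage_mono[of m "n + m"] by auto
  ultimately show "X \<in> stage n" by blast
qed (use stage_le_top stage_subset_lim in blast)+

lemma stage_down: "\<lbrakk>X \<in> carrier lim; X \<sqsubseteq>\<^bsub>lim\<^esub> Y; Y \<in> stage n\<rbrakk> \<Longrightarrow> X \<in> stage n"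
  unfolding stage_iff_le_top using lim_trans[where x = X and y = Y and z = "stage_top n"] top_in_lim by simp

section \<open>The invariants \<open>\<rho>\<close> and \<open>\<nu>\<close> of the limit\<close>

text \<open>The definite description has a unique value because two representatives meet at a later
  stage and the transition maps preserve rank.\<close>

lemma limit_rank_cls:
  assumes "x \<in> carrier (L n)"
  shows "limit_rank L (cls n x) = rank (L n) x"
  unfolding limit_rank_def
proof (rule the_equality)
  show "\<exists>m y. (m, y) \<in> cls n x \<and> rank (L n) x = rank (L m) y"
    using cls_refl by blast
  fix r
  assume "\<exists>m y. (m, y) \<in> cls n x \<and> r = rank (L m) y"
  then obtain m y where y: "(m, y) \<in> cls n x" "r = rank (L m) y" by blast
  obtain d e where "n + d = m + e" "up d n x = up e m y"
    using mem_cls(2)[OF y(1) assms] by blast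
  then show "r = rank (L n) x"
    using rank_up[OF assms, of d] rank_up[OF mem_cls(1)[OF y(1) assms], of e] y(2) by simp
qed

text \<open>Representatives can be pushed upward, so the stages containing \<open>X\<close> are
  exactly those from the least one onward.\<close>

lemma limit_nu_le_iff:
  assumes "X \<in> carrier lim"
  shows "limit_nu X \<le> n \<longleftrightarrow> X \<in> stage n"
proof -
  obtain m z where z: "z \<in> carrier (L m)" "X = cls m z"
    using lim_in_stage[OF assms] by (metis stage_cases)
  have mem: "(\<exists>x. (n, x) \<in> X) \<longleftrightarrow> X \<in> stage n" for n
  proof
    assume "\<exists>x. (n, x) \<in> X"
    then obtain x where x: "(n, x) \<in> cls m z" using z by blast
    show "X \<in> stage n"
      using cls_in_stage[OF mem_cls(1)[OF x z(1)]] cls_eq[OF x HOL.refl] z(2) by simp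
  next
    assume "X \<in> stage n"
    then show "\<exists>x. (n, x) \<in> X" using cls_refl by (metis stage_cases)
  qed
  have nu: "limit_nu X = (LEAST n. X \<in> stage n)"
    unfolding limit_nu_def mem ..
  show ?thesis
  proof
    assume "limit_nu X \<le> n"
    moreover have "X \<in> stage (limit_nu X)"
      unfolding nu by (rule LeastI_ex[OF lim_in_stage[OF assms]])
    ultimately show "X \<in> stage n" using stage_mono by blast
  qed (simp add: nu Least_le)
qed

section \<open>Meets with stage tops, and joins\<close>

text \<open>The meet is formed at a stage \<open>N\<close> containing both elements. Stages are
  ideals, so every lower bound in the limit already lives there. This meet truncates an arbitrary
  element to stage \<open>n\<close>.\<close>

lemma lim_meet_top:
  assumes "Z \<in> carrier lim"
  shows "\<exists>W\<in>stage n. W \<sqsubseteq>\<^bsub>lim\<^esub> Z \<and>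
    (\<forall>V\<in>carrier lim. V \<sqsubseteq>\<^bsub>lim\<^esub> Z \<longrightarrow> V \<sqsubseteq>\<^bsub>lim\<^esub> stage_top n \<longrightarrow> V \<sqsubseteq>\<^bsub>lim\<^esub> W)"
proof -
  obtain N where N: "Z \<in> stage N" "stage_top n \<in> stage N"
    using lim_common2[OF assms top_in_lim[of n]] .
  obtain z where z: "z \<in> carrier (L N)" "Z = cls N z" using N(1) by (rule stage_cases)
  obtain u where u: "u \<in> carrier (L N)" "stage_top n = cls N u" using N(2) by (rule stage_cases)
  note m = L_meet[OF z(1) u(1)]
  show ?thesis
  proof (intro bexI[of _ "cls N (z \<sqinter>\<^bsub>L N\<^esub> u)"] conjI ballI impI)
    show "cls N (z \<sqinter>\<^bsub>L N\<^esub> u) \<sqsubseteq>\<^bsub>lim\<^esub> Z" using m z cls_le by simp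
    show "cls N (z \<sqinter>\<^bsub>L N\<^esub> u) \<in> stage n"
      unfolding stage_iff_le_top u(2) using m(1,3) u(1) cls_le cls_in_stage stage_subset_lim by blast
    fix V assume V: "V \<in> carrier lim" "V \<sqsubseteq>\<^bsub>lim\<^esub> Z" "V \<sqsubseteq>\<^bsub>lim\<^esub> stage_top n"
    obtain v where v: "v \<in> carrier (L N)" "V = cls N v"
      using stage_down[OF V(1,2) N(1)] by (rule stage_cases)
    then show "V \<sqsubseteq>\<^bsub>lim\<^esub> cls N (z \<sqinter>\<^bsub>L N\<^esub> u)"
      using V(2,3) z u m(1) m(4)[of v] cls_le by simp
  qed
qed

text \<open>The join formed at a common stage \<open>n\<close> is still least in the limit: an upper
  bound \<open>Z\<close> from a later stage can be replaced by its truncation to stage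
  \<open>n\<close>.\<close>

lemma lim_join:
  assumes XY: "X \<in> carrier lim" "Y \<in> carrier lim"
  shows "\<exists>S. is_lub lim S {X, Y}"
proof -
  obtain n where n: "X \<in> stage n" "Y \<in> stage n" using lim_common2[OF XY] .
  obtain x where x: "x \<in> carrier (L n)" "X = cls n x" using n(1) by (rule stage_cases)
  obtain y where y: "y \<in> carrier (L n)" "Y = cls n y" using n(2) by (rule stage_cases)
  note j = L_join[OF x(1) y(1)]
  have "cls n (x \<squnion>\<^bsub>L n\<^esub> y) \<sqsubseteq>\<^bsub>lim\<^esub> Z"
    if Z: "Z \<in> carrier lim" "X \<sqsubseteq>\<^bsub>lim\<^esub> Z" "Y \<sqsubseteq>\<^bsub>lim\<^esub> Z" for Z
  proof -
    obtain W where W: "W \<in> stage n" "W \<sqsubseteq>\<^bsub>lim\<^esub> Z" "X \<sqsubseteq>\<^bsub>lim\<^esub> W" "Y \<sqsubseteq>\<^bsub>lim\<^esub> W"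
      using lim_meet_top[OF Z(1), of n] Z XY n stage_le_top by metis
    obtain w where w: "w \<in> carrier (L n)" "W = cls n w" using W(1) by (rule stage_cases)
    have "cls n (x \<squnion>\<^bsub>L n\<^esub> y) \<sqsubseteq>\<^bsub>lim\<^esub> W"
      using W(3,4) x y w j(1) j(4)[of w] cls_le by simp
    then show ?thesis
      using lim_trans[OF _ W(2)] cls_in_stage[OF j(1)] W(1) Z(1) stage_subset_lim by blast
  qed
  moreover have "cls n (x \<squnion>\<^bsub>L n\<^esub> y) \<in> carrier lim" using cls_in_lim[OF j(1)] .
  ultimately have "is_lub lim (cls n (x \<squnion>\<^bsub>L n\<^esub> y)) {X, Y}"
    unfolding is_lub_pair_iff[OF XY] using x y j cls_le by simp
  then show ?thesis ..
qed

section \<open>Gluing the maps \<open>\<theta>\<close>\<close>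

definition rep :: "nat \<Rightarrow> (nat \<times> 'a) set \<Rightarrow> 'a" where
  "rep n = inv_into (carrier (L n)) (cls n)"

lemma rep_cls: "x \<in> carrier (L n) \<Longrightarrow> rep n (cls n x) = x"
  unfolding rep_def by (rule inv_into_f_f) (auto intro: inj_onI cls_inj)

definition lim_theta_at :: "nat \<Rightarrow> (nat \<times> 'a) set \<Rightarrow> (nat \<times> 'a) set \<Rightarrow> (nat \<times> 'a) set" where
  "lim_theta_at n S X = cls n (\<theta> (Suc n) (rep (Suc n) S) (rep (Suc n) X))"

text \<open>The least stage is only a choice: for an atom \<open>S\<close> below \<open>X\<close>,
  \<open>lim_theta_at_Suc\<close> shows that all later stages give the same value. \<open>S\<close>
  lies in every stage containing \<open>X\<close>, since stages are ideals.\<close>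

definition lim_theta :: "(nat \<times> 'a) set \<Rightarrow> (nat \<times> 'a) set \<Rightarrow> (nat \<times> 'a) set" where
  "lim_theta S X = lim_theta_at (LEAST n. X \<in> stage (Suc n)) S X"

lemma lim_atom_rep:
  assumes S: "S \<in> carrier lim" "limit_rank L S = 1" and X: "X \<in> stage (Suc n)" "S \<sqsubseteq>\<^bsub>lim\<^esub> X"
  obtains s x where "s \<in> atoms (L (Suc n))" "S = cls (Suc n) s"
    "x \<in> carrier (L (Suc n))" "X = cls (Suc n) x" "s \<sqsubseteq>\<^bsub>L (Suc n)\<^esub> x"
proof -
  obtain x where x: "x \<in> carrier (L (Suc n))" "X = cls (Suc n) x"
    using X(1) by (rule stage_cases)
  obtain s where s: "s \<in> carrier (L (Suc n))" "S = cls (Suc n) s"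
    using stage_down[OF S(1) X(2,1)] by (rule stage_cases)
  have "s \<in> atoms (L (Suc n))"
    using s S(2) limit_rank_cls by (simp add: atoms_iff_rank)
  moreover have "s \<sqsubseteq>\<^bsub>L (Suc n)\<^esub> x" using X(2) s x cls_le by simp
  ultimately show ?thesis using that s x by blast
qed

text \<open>Independence of the stage is exactly the compatibility of \<open>\<theta>\<close> with
  \<open>\<iota>\<close> required of a uniform sequence.\<close>

lemma lim_theta_at_Suc:
  assumes "S \<in> carrier lim" "limit_rank L S = 1" "X \<in> stage (Suc n)" "S \<sqsubseteq>\<^bsub>lim\<^esub> X"
  shows "lim_theta_at (Suc n) S X = lim_theta_at n S X"
proof -
  obtain s x where s: "s \<in> atoms (L (Suc n))" "S = cls (Suc n) s"
    and x: "x \<in> carrier (L (Suc n))" "X = cls (Suc n) x" "s \<sqsubseteq>\<^bsub>L (Suc n)\<^esub> x"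
    using lim_atom_rep[OF assms] .
  have sL: "s \<in> carrier (L (Suc n))" using s atoms_iff_rank by blast
  have "rep (Suc (Suc n)) S = \<iota> (Suc n) s" "rep (Suc (Suc n)) X = \<iota> (Suc n) x"
    using rep_cls[OF iota_in[OF sL]] rep_cls[OF iota_in[OF x(1)]] cls_iota sL x s by simp_all
  moreover have "x \<in> \<lbrace>s..\<top>\<^bsub>L (Suc n)\<^esub>\<rbrace>\<^bsub>L (Suc n)\<^esub>"
    using x L_top(2) by (simp add: at_least_at_most_iff)
  moreover have "rep (Suc n) S = s" "rep (Suc n) X = x"
    using rep_cls sL x s by simp_all
  ultimately show ?thesis
    unfolding lim_theta_at_def
    using iota_theta[OF s(1)] cls_iota[OF theta_in[OF s(1) x(1,3)]] by metis
qed

lemma lim_theta_eq: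
  assumes s: "s \<in> atoms (L (Suc n))" and x: "x \<in> carrier (L (Suc n))" "s \<sqsubseteq>\<^bsub>L (Suc n)\<^esub> x"
  shows "lim_theta (cls (Suc n) s) (cls (Suc n) x) = cls n (\<theta> (Suc n) s x)"
proof -
  let ?S = "cls (Suc n) s" and ?X = "cls (Suc n) x"
  have sL: "s \<in> carrier (L (Suc n))" "rank (L (Suc n)) s = 1" using s atoms_iff_rank by auto
  then have S: "?S \<in> carrier lim" "limit_rank L ?S = 1" "?S \<sqsubseteq>\<^bsub>lim\<^esub> ?X"
    using cls_in_lim limit_rank_cls cls_le x by auto
  let ?m = "LEAST n. ?X \<in> stage (Suc n)"
  have m: "?X \<in> stage (Suc ?m)" "?m \<le> n"
    using LeastI[of "\<lambda>n. ?X \<in> stage (Suc n)" n] Least_le[of "\<lambda>n. ?X \<in> stage (Suc n)" n] cls_in_stage[OF x(1)]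
    by simp_all
  have "lim_theta_at k ?S ?X = lim_theta_at ?m ?S ?X" if "?m \<le> k" for k
    using that
  proof (induction rule: dec_induct)
    case (step k)
    have "?X \<in> stage (Suc k)" using m(1) stage_mono[of "Suc ?m" "Suc k"] step.hyps by blast
    then show ?case using lim_theta_at_Suc[OF S(1,2) _ S(3)] step.IH by simp
  qed simp
  from this[OF m(2)] show ?thesis
    unfolding lim_theta_def by (simp add: lim_theta_at_def rep_cls sL x)
qed

text \<open>Finitely many elements share a stage, where \<open>lim_theta S\<close> is one of the
  given \<open>\<theta>\<close>; order, rank and preimages are read off there.\<close>

lemma lim_theta_iso:
  assumes S: "S \<in> carrier lim" "limit_rank L S = 1"
  shows "order_iso (principal_filter lim S) lim (lim_theta S)"
    and "\<lbrakk>X \<in> carrier lim; S \<sqsubseteq>\<^bsub>lim\<^esub> X\<rbrakk> \<Longrightarrow> limit_rank L X = Suc (limit_rank L (lim_theta S X))"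
    and "\<lbrakk>X \<in> carrier lim; S \<sqsubseteq>\<^bsub>lim\<^esub> X; S \<sqsubseteq>\<^bsub>lim\<^esub> stage_top (Suc n)\<rbrakk> \<Longrightarrow>
      X \<sqsubseteq>\<^bsub>lim\<^esub> stage_top (Suc n) \<longleftrightarrow> lim_theta S X \<sqsubseteq>\<^bsub>lim\<^esub> stage_top n"
proof -
  let ?F = "{X \<in> carrier lim. S \<sqsubseteq>\<^bsub>lim\<^esub> X}"
  have Suc: "\<exists>n. X \<in> stage (Suc n) \<and> Y \<in> stage (Suc n)" if XY: "X \<in> carrier lim" "Y \<in> carrier lim" for X Y
  proof -
    obtain n where "X \<in> stage n" "Y \<in> stage n" using lim_common2[OF XY] .
    then show ?thesis using stage_mono[of n "Suc n"] by auto
  qed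
  have le: "lim_theta S X \<sqsubseteq>\<^bsub>lim\<^esub> lim_theta S Y \<longleftrightarrow> X \<sqsubseteq>\<^bsub>lim\<^esub> Y" if XY: "X \<in> ?F" "Y \<in> ?F" for X Y
  proof -
    obtain n where n: "X \<in> stage (Suc n)" "Y \<in> stage (Suc n)" using Suc XY by blast
    obtain s x where s: "s \<in> atoms (L (Suc n))" "S = cls (Suc n) s"
      and x: "x \<in> carrier (L (Suc n))" "X = cls (Suc n) x" "s \<sqsubseteq>\<^bsub>L (Suc n)\<^esub> x"
      using lim_atom_rep[OF S n(1)] XY by blast
    obtain s' y where s': "s' \<in> atoms (L (Suc n))" "S = cls (Suc n) s'"
      and y: "y \<in> carrier (L (Suc n))" "Y = cls (Suc n) y" "s' \<sqsubseteq>\<^bsub>L (Suc n)\<^esub> y"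
      using lim_atom_rep[OF S n(2)] XY by blast
    have "s' = s" using cls_inj[of s' "Suc n" s] s s' atoms_iff_rank by auto
    then show ?thesis
      using lim_theta_eq[OF s(1)] x y s(2) cls_le theta_in[OF s(1)] theta_le[OF s(1)] by simp
  qed
  have closed: "lim_theta S X \<in> stage n" if X: "X \<in> stage (Suc n)" "S \<sqsubseteq>\<^bsub>lim\<^esub> X" for X n
  proof -
    obtain s x where s: "s \<in> atoms (L (Suc n))" "S = cls (Suc n) s"
      and x: "x \<in> carrier (L (Suc n))" "X = cls (Suc n) x" "s \<sqsubseteq>\<^bsub>L (Suc n)\<^esub> x"
      using lim_atom_rep[OF S X] .
    then show ?thesis using lim_theta_eq[OF s(1) x(1,3)] cls_in_stage theta_in by simp
  qed
  \<comment> \<open>The preimage is kept within stage \<open>Suc n\<close>; the stage equivalence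
    below depends on this.\<close>
  have onto: "\<exists>X. X \<in> stage (Suc n) \<and> S \<sqsubseteq>\<^bsub>lim\<^esub> X \<and> lim_theta S X = Y"
    if Y: "Y \<in> stage n" and SD: "S \<in> stage (Suc n)" for Y n
  proof -
    obtain s where s: "s \<in> carrier (L (Suc n))" "S = cls (Suc n) s" using SD by (rule stage_cases)
    then have sA: "s \<in> atoms (L (Suc n))" using S(2) limit_rank_cls atoms_iff_rank by simp
    obtain y where y: "y \<in> carrier (L n)" "Y = cls n y" using Y by (rule stage_cases)
    then obtain x where x: "x \<in> carrier (L (Suc n))" "s \<sqsubseteq>\<^bsub>L (Suc n)\<^esub> x" "y = \<theta> (Suc n) s x"
      using bij_betw_imp_surj_on[OF theta_bij[OF sA]] by (metis (no_types, lifting) imageE mem_Collect_eq)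
    then show ?thesis
      using lim_theta_eq[OF sA x(1,2)] cls_in_stage cls_le s y by (intro exI[of _ "cls (Suc n) x"]) simp
  qed
  have inj: "X = Y" if "X \<in> ?F" "Y \<in> ?F" "lim_theta S X = lim_theta S Y" for X Y
  proof (rule lim_antisym)
    have "lim_theta S X \<in> carrier lim"
      using closed Suc that(1) stage_subset_lim by blast
    then have "lim_theta S X \<sqsubseteq>\<^bsub>lim\<^esub> lim_theta S Y" "lim_theta S Y \<sqsubseteq>\<^bsub>lim\<^esub> lim_theta S X"
      using that(3) lim_refl by simp_all
    then show "X \<sqsubseteq>\<^bsub>lim\<^esub> Y" "Y \<sqsubseteq>\<^bsub>lim\<^esub> X" using le that(1,2) by simp_all
  qed (use that in auto)
  have "lim_theta S ` ?F = carrier lim"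
  proof (intro equalityI subsetI)
    fix Y assume "Y \<in> lim_theta S ` ?F"
    then show "Y \<in> carrier lim" using closed Suc stage_subset_lim by blast
  next
    fix Y assume Y: "Y \<in> carrier lim"
    obtain n where "Y \<in> stage n" "S \<in> stage n" using lim_common2[OF Y S(1)] .
    then obtain X where "X \<in> stage (Suc n)" "S \<sqsubseteq>\<^bsub>lim\<^esub> X" "lim_theta S X = Y"
      using onto[of Y n] stage_mono[of n "Suc n"] by auto
    then show "Y \<in> lim_theta S ` ?F" using stage_subset_lim by blast
  qed
  then have "bij_betw (lim_theta S) ?F (carrier lim)"
    using inj by (intro bij_betw_imageI inj_onI)
  moreover have "weak_partial_order (principal_filter lim S)"
    unfolding principal_filter_def by (rule weak_partial_order_subset[OF lim_wpo]) blast
  ultimately show "order_iso (principal_filter lim S) lim (lim_theta S)"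
    unfolding order_iso_def order_emb_def using le lim_wpo by (simp add: principal_filter_def)
  show "limit_rank L X = Suc (limit_rank L (lim_theta S X))"
    if X: "X \<in> carrier lim" "S \<sqsubseteq>\<^bsub>lim\<^esub> X"
  proof -
    obtain n where n: "X \<in> stage (Suc n)" using Suc X(1) by blast
    obtain s x where s: "s \<in> atoms (L (Suc n))" "S = cls (Suc n) s"
      and x: "x \<in> carrier (L (Suc n))" "X = cls (Suc n) x" "s \<sqsubseteq>\<^bsub>L (Suc n)\<^esub> x"
      using lim_atom_rep[OF S n X(2)] .
    then show ?thesis
      using lim_theta_eq[OF s(1) x(1,3)] limit_rank_cls theta_in[OF s(1) x(1,3)]
        rank_theta[OF s(1) x(1,3)] by simp
  qed
  show "X \<sqsubseteq>\<^bsub>lim\<^esub> stage_top (Suc n) \<longleftrightarrow> lim_theta S X \<sqsubseteq>\<^bsub>lim\<^esub> stage_top n"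
    if X: "X \<in> carrier lim" "S \<sqsubseteq>\<^bsub>lim\<^esub> X" and ST: "S \<sqsubseteq>\<^bsub>lim\<^esub> stage_top (Suc n)"
  proof
    assume "X \<sqsubseteq>\<^bsub>lim\<^esub> stage_top (Suc n)"
    then show "lim_theta S X \<sqsubseteq>\<^bsub>lim\<^esub> stage_top n" using closed X stage_iff_le_top by blast
  next
    assume "lim_theta S X \<sqsubseteq>\<^bsub>lim\<^esub> stage_top n"
    moreover have "lim_theta S X \<in> carrier lim" using closed Suc X stage_subset_lim by blast
    ultimately obtain X' where X': "X' \<in> stage (Suc n)" "S \<sqsubseteq>\<^bsub>lim\<^esub> X'" "lim_theta S X' = lim_theta S X"
      using onto[of "lim_theta S X" n] S(1) ST stage_iff_le_top by blast
    \<comment> \<open>The value has a preimage in stage \<open>Suc n\<close>, and by injectivity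
      this preimage is \<open>X\<close> itself.\<close>
    then have "X' = X" using inj X stage_subset_lim by blast
    then show "X \<sqsubseteq>\<^bsub>lim\<^esub> stage_top (Suc n)" using X' stage_le_top by blast
  qed
qed

section \<open>The direct limit as a rank tower\<close>

lemma rank_tower_lim: "rank_tower lim stage_top (limit_rank L)"
proof (intro rank_tower.intro lim_po rank_tower_axioms.intro)
  show "stage_top n \<in> carrier lim" for n by (rule top_in_lim)
  show "stage_top n \<sqsubseteq>\<^bsub>lim\<^esub> stage_top (Suc n)" for n
    by (rule stage_le_top) (use top_in_stage[of n] stage_mono[of n "Suc n"] in auto)
  show "\<exists>n. X \<sqsubseteq>\<^bsub>lim\<^esub> stage_top n" if "X \<in> carrier lim" for X
    using lim_in_stage[OF that] stage_le_top by blast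
  show "finite {X \<in> carrier lim. X \<sqsubseteq>\<^bsub>lim\<^esub> stage_top n}" for n
    unfolding stage_iff_le_top[symmetric] by (simp add: stage_def L_finite)
  show rank_T: "limit_rank L (stage_top n) = n" for n
    by (simp add: stage_top_def limit_rank_cls L_top rank_top_L)
  show less: "limit_rank L X < limit_rank L Y"
    if XY: "X \<in> carrier lim" "Y \<in> carrier lim" "X \<sqsubseteq>\<^bsub>lim\<^esub> Y" "X \<noteq> Y" for X Y
  proof -
    obtain n where n: "X \<in> stage n" "Y \<in> stage n" using lim_common2[OF XY(1,2)] .
    obtain x where x: "x \<in> carrier (L n)" "X = cls n x" using n(1) by (rule stage_cases)
    obtain y where y: "y \<in> carrier (L n)" "Y = cls n y" using n(2) by (rule stage_cases)
    show ?thesis using rank_less[OF x(1) y(1)] XY(3,4) x y cls_le limit_rank_cls by auto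
  qed
  show "stage_top 0 \<sqsubseteq>\<^bsub>lim\<^esub> X" if X: "X \<in> carrier lim" for X
  proof -
    obtain n where n: "X \<in> stage n" "stage_top 0 \<in> stage n" using lim_common2[OF X top_in_lim[of 0]] .
    obtain x where x: "x \<in> carrier (L n)" "X = cls n x" using n(1) by (rule stage_cases)
    obtain y where y: "y \<in> carrier (L n)" "stage_top 0 = cls n y" using n(2) by (rule stage_cases)
    \<comment> \<open>Rank zero identifies the representative of \<open>stage_top 0\<close> as the
      bottom of \<open>L n\<close>.\<close>
    have "rank (L n) y = 0" using rank_T[of 0] y limit_rank_cls by simp
    then have "y = \<bottom>\<^bsub>L n\<^esub>"
      using rank_less[OF L_bottom(1) y(1) L_bottom(2)[OF y(1)]] by auto
    then show ?thesis using x y L_bottom cls_le by simp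
  qed
  show "\<exists>Z\<in>carrier lim. X \<sqsubseteq>\<^bsub>lim\<^esub> Z \<and> Z \<sqsubseteq>\<^bsub>lim\<^esub> Y \<and> limit_rank L Y = Suc (limit_rank L Z)"
    if XY: "X \<in> carrier lim" "Y \<in> carrier lim" "X \<sqsubseteq>\<^bsub>lim\<^esub> Y" "X \<noteq> Y" for X Y
  proof -
    obtain n where n: "X \<in> stage n" "Y \<in> stage n" using lim_common2[OF XY(1,2)] .
    obtain x where x: "x \<in> carrier (L n)" "X = cls n x" using n(1) by (rule stage_cases)
    obtain y where y: "y \<in> carrier (L n)" "Y = cls n y" using n(2) by (rule stage_cases)
    have "x \<sqsubseteq>\<^bsub>L n\<^esub> y" "x \<noteq> y" using XY(3,4) x y cls_le by auto
    then obtain z where z: "z \<in> carrier (L n)" "covers (L n) y z" "x \<sqsubseteq>\<^bsub>L n\<^esub> z"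
      using L_cover_below x(1) y(1) by blast
    then have "z \<sqsubseteq>\<^bsub>L n\<^esub> y" unfolding covers_def L_lless by blast
    then show ?thesis
      using z x y cls_le limit_rank_cls rank_covers[OF z(2)] cls_in_lim
      by (intro bexI[of _ "cls n z"]) auto
  qed
  show "\<exists>S. is_lub lim S {X, Y}" if "X \<in> carrier lim" "Y \<in> carrier lim" for X Y
    using lim_join that .
  show "\<exists>Z\<in>carrier lim. Z \<sqsubseteq>\<^bsub>lim\<^esub> X \<and> Z \<sqsubseteq>\<^bsub>lim\<^esub> stage_top n \<and> limit_rank L X = Suc (limit_rank L Z) \<and>
      (\<forall>W\<in>carrier lim. W \<sqsubseteq>\<^bsub>lim\<^esub> X \<longrightarrow> W \<sqsubseteq>\<^bsub>lim\<^esub> stage_top n \<longrightarrow> W \<sqsubseteq>\<^bsub>lim\<^esub> Z)"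
    if X: "X \<in> carrier lim" "X \<sqsubseteq>\<^bsub>lim\<^esub> stage_top (Suc n)" "\<not> X \<sqsubseteq>\<^bsub>lim\<^esub> stage_top n" for X n
  proof -
    have XD: "X \<in> stage (Suc n)" using X stage_iff_le_top by blast
    then obtain x where x: "x \<in> carrier (L (Suc n))" "X = cls (Suc n) x" by (rule stage_cases)
    \<comment> \<open>At stage \<open>Suc n\<close> the element \<open>stage_top n\<close> is the
      coatom \<open>t n\<close>, so \<open>rank_modular_meet\<close> gives the drop in rank.\<close>
    have "\<not> x \<sqsubseteq>\<^bsub>L (Suc n)\<^esub> t n" using X(3) x cls_le t_in by (simp add: stage_top_eq_t)
    note r = rank_modular_meet[OF x(1) this] and m = L_meet[OF t_in x(1)]
    let ?z = "t n \<sqinter>\<^bsub>L (Suc n)\<^esub> x"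
    have "W \<sqsubseteq>\<^bsub>lim\<^esub> cls (Suc n) ?z"
      if W: "W \<in> carrier lim" "W \<sqsubseteq>\<^bsub>lim\<^esub> X" "W \<sqsubseteq>\<^bsub>lim\<^esub> stage_top n" for W
    proof -
      obtain w where w: "w \<in> carrier (L (Suc n))" "W = cls (Suc n) w"
        using stage_down[OF W(1,2) XD] by (rule stage_cases)
      then show ?thesis
        using W(2,3) x t_in m(1) m(4)[of w] cls_le by (simp add: stage_top_eq_t)
    qed
    moreover have "cls (Suc n) ?z \<in> carrier lim" using cls_in_lim[OF m(1)] .
    ultimately show ?thesis
      using x t_in m(1-3) r cls_le limit_rank_cls
      by (intro bexI[of _ "cls (Suc n) ?z"]) (simp_all add: stage_top_eq_t)
  qed
  show "stage_top n \<sqsubseteq>\<^bsub>lim\<^esub> Z"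
    if Z: "Z \<in> carrier lim"
      "\<And>S. \<lbrakk>S \<in> carrier lim; limit_rank L S = 1; S \<sqsubseteq>\<^bsub>lim\<^esub> stage_top n\<rbrakk> \<Longrightarrow> S \<sqsubseteq>\<^bsub>lim\<^esub> Z" for Z n
  proof -
    \<comment> \<open>\<open>W\<close> is the truncation of \<open>Z\<close> to stage
      \<open>n\<close>. It lies above all atoms of \<open>L n\<close>, and atomicity of
      \<open>L n\<close> puts it above the top.\<close>
    obtain W where W: "W \<in> stage n" "W \<sqsubseteq>\<^bsub>lim\<^esub> Z"
      "\<And>V. \<lbrakk>V \<in> carrier lim; V \<sqsubseteq>\<^bsub>lim\<^esub> Z; V \<sqsubseteq>\<^bsub>lim\<^esub> stage_top n\<rbrakk> \<Longrightarrow> V \<sqsubseteq>\<^bsub>lim\<^esub> W"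
      using lim_meet_top[OF Z(1), of n] by blast
    obtain w where w: "w \<in> carrier (L n)" "W = cls n w" using W(1) by (rule stage_cases)
    have "a \<sqsubseteq>\<^bsub>L n\<^esub> w" if "a \<in> atoms (L n)" for a
    proof -
      have a: "a \<in> carrier (L n)" "rank (L n) a = 1" using that atoms_iff_rank by auto
      then have "cls n a \<in> carrier lim" "limit_rank L (cls n a) = 1" "cls n a \<sqsubseteq>\<^bsub>lim\<^esub> stage_top n"
        using cls_in_stage cls_in_lim limit_rank_cls stage_le_top by auto
      then have "cls n a \<sqsubseteq>\<^bsub>lim\<^esub> W" using Z(2) W(3) by blast
      then show ?thesis using cls_le a w by simp
    qed
    then have "stage_top n \<sqsubseteq>\<^bsub>lim\<^esub> W"
      unfolding stage_top_def using top_le_atom_bound[OF w(1)] cls_le[OF L_top(1) w(1)] w(2) by simp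
    then show ?thesis
      using lim_trans[OF _ W(2) top_in_lim] W(1) stage_subset_lim Z(1) by blast
  qed
  show "\<exists>\<phi>. order_iso (principal_filter lim S) lim \<phi> \<and>
      (\<forall>X\<in>carrier lim. S \<sqsubseteq>\<^bsub>lim\<^esub> X \<longrightarrow> limit_rank L X = Suc (limit_rank L (\<phi> X)) \<and>
        (\<forall>n. S \<sqsubseteq>\<^bsub>lim\<^esub> stage_top (Suc n) \<longrightarrow> (X \<sqsubseteq>\<^bsub>lim\<^esub> stage_top (Suc n) \<longleftrightarrow> \<phi> X \<sqsubseteq>\<^bsub>lim\<^esub> stage_top n)))"
    if S: "S \<in> carrier lim" "limit_rank L S = 1" for S
    by (intro exI[of _ "lim_theta S"] conjI ballI impI allI lim_theta_iso[OF S])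
qed

text \<open>Over the integers, \<open>\<nu> - \<rho> < j + 1\<close> says
  \<open>\<nu> \<le> j + \<rho>\<close>, which \<open>limit_nu_le_iff\<close> turns into membership
  in a stage.\<close>

lemma limit_sub_eq_slice: "limit_sub L \<iota> (Suc j) = rank_tower.slice lim stage_top (limit_rank L) j"
proof -
  interpret rank_tower lim stage_top "limit_rank L" by (rule rank_tower_lim)
  have "int (limit_nu X) - int (limit_rank L X) < int (Suc j) \<longleftrightarrow> X \<sqsubseteq>\<^bsub>lim\<^esub> stage_top (j + limit_rank L X)"
    if "X \<in> carrier lim" for X
  proof -
    have "int (limit_nu X) - int (limit_rank L X) < int (Suc j) \<longleftrightarrow> limit_nu X \<le> j + limit_rank L X"
      by linarith
    then show ?thesis using limit_nu_le_iff[OF that] stage_iff_le_top that by simp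
  qed
  then show ?thesis unfolding limit_sub_def slice_def by (metis (no_types, lifting) Collect_cong)
qed

lemma order_isomorphic_below_top:
  "order_isomorphic (lim\<lparr>carrier := {X \<in> carrier lim. X \<sqsubseteq>\<^bsub>lim\<^esub> stage_top n}\<rparr>) (L n)"
proof -
  have below: "{X \<in> carrier lim. X \<sqsubseteq>\<^bsub>lim\<^esub> stage_top n} = stage n" using stage_iff_le_top by blast
  have "bij_betw (cls n) (carrier (L n)) (stage n)"
    unfolding stage_def by (rule inj_on_imp_bij_betw) (auto intro: inj_onI cls_inj)
  then have "bij_betw (rep n) (stage n) (carrier (L n))"
    unfolding rep_def by (rule bij_betw_inv_into)
  moreover have "rep n X \<sqsubseteq>\<^bsub>L n\<^esub> rep n Y \<longleftrightarrow> X \<sqsubseteq>\<^bsub>lim\<^esub> Y" if "X \<in> stage n" "Y \<in> stage n" for X Y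
    using that by (elim stage_cases) (simp add: rep_cls cls_le)
  moreover have "weak_partial_order (lim\<lparr>carrier := stage n\<rparr>)"
    by (rule weak_partial_order_subset[OF lim_wpo stage_subset_lim])
  ultimately have "order_iso (lim\<lparr>carrier := stage n\<rparr>) (L n) (rep n)"
    unfolding order_iso_def order_emb_def using L_wpo by simp
  then show ?thesis unfolding below order_isomorphic_def by blast
qed

end

theorem theorem3p16:
  fixes L :: "nat \<Rightarrow> 'a gorder"
    and \<theta> :: "nat \<Rightarrow> 'a \<Rightarrow> 'a \<Rightarrow> 'a"
    and \<iota> :: "nat \<Rightarrow> 'a \<Rightarrow> 'a"
    and t :: "nat \<Rightarrow> 'a"
    and k :: nat
  assumes "uniform_sequence L \<theta> \<iota> t"
    and "k \<ge> 1"
  shows "upho_lattice (limit_sub L \<iota> k) \<and>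
         order_isomorphic (core (limit_sub L \<iota> k)) (L k)"
proof -
  interpret uniform_sequence L \<theta> \<iota> t by fact
  interpret lim: rank_tower lim stage_top "limit_rank L" by (rule rank_tower_lim)
  \<comment> \<open>Slices are indexed by \<open>j = k - 1\<close>, so the core of slice
    \<open>j\<close> is the ideal below \<open>stage_top k\<close>.\<close>
  obtain j where k: "k = Suc j" using assms(2) by (cases k) auto
  show ?thesis
    unfolding k limit_sub_eq_slice lim.core_slice
    using lim.upho_lattice_slice order_isomorphic_below_top by blast
qed

end
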